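(* Let $K,k$ be two CPNC kernels on the same NC set $\Omega$. Define isometries $U_\vee:\mathcal{H}_{nc}(K\vee k)\to\mathcal{H}_{nc}(K)\oplus\mathcal{H}_{nc}(k)$ and $U_\wedge:\mathcal{H}_{nc}(K\wedge k)\to\mathcal{H}_{nc}(K)\oplus\mathcal{H}_{nc}(k)$ by $$U_\vee(K\vee k)_Z:=K_Z\oplus k_Z\quad(Z\in\Omega),\qquad U_\wedge h:=h\oplus(-h).$$ Then $$\mathcal{H}_{nc}(K)\oplus\mathcal{H}_{nc}(k)=U_\vee\mathcal{H}_{nc}(K\vee k)\oplus U_\wedge\mathcal{H}_{nc}(K\wedge k)$$ (orthogonal direct sum), and for all $Z\in\Omega$, $$(K\wedge k)_Z=\tfrac12U_\wedge^*(K_Z\oplus-k_Z)=U_\wedge^*(K_Z\oplus0)=U_\wedge^*(0\oplus-k_Z).$$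
   Context: Let $d\in\mathbb{N}$. An NC set $\Omega=\bigsqcup_n\Omega_n$, $\Omega_n\subseteq\mathbb{C}^{n\times n}\otimes\mathbb{C}^{1\times d}$, is a set of $d$-tuples of square matrices closed under direct sums. A free NC function on $\Omega$ is a function $f:\Omega\to\bigsqcup_n\mathbb{C}^{n\times n}$ which maps $\Omega_n$ into $\mathbb{C}^{n\times n}$ and respects direct sums and joint similarities. A non-commutative reproducing kernel Hilbert space (NC-RKHS) on $\Omega$ is a Hilbert space $\mathcal{H}$ of free NC functions on $\Omega$ such that for every $n$ and $Z\in\Omega_n$ the evaluation $\ell_Z:\mathcal{H}\to(\mathbb{C}^{n\times n},\mathrm{tr}_n)$, $f\mapsto f(Z)$, is bounded. Its adjoint is the kernel map $K_Z:=\ell_Z^*:\mathbb{C}^{n\times n}\to\mathcal{H}$, so $\langle K_Z(yv^* ),f\rangle=y^*f(Z)v$ for $y,v\in\mathbb{C}^n$ (inner products are conjugate-linear in the first argument). The completely positive non-commutative (CPNC) kernel of $\mathcal{H}$ is given, for $Z\in\Omega_n$, $W\in\Omega_m$, by the linear map $K(Z,W)[\cdot]:\mathbb{C}^{n\times m}\to\mathbb{C}^{n\times m}$ with $y^*K(Z,W)[vu^*]x=\langle K_Z(yv^* ),K_W(xu^* )\rangle_{\mathcal{H}}$. CPNC kernels and NC-RKHS on $\Omega$ are in bijective correspondence; $\mathcal{H}_{nc}(K)$ is the NC-RKHS with kernel $K$. For CPNC kernels $K,k$ on $\Omega$: $(K\vee k)(Z,W):=K(Z,W)+k(Z,W)$,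 with NC-RKHS $\mathcal{H}_{nc}(K\vee k)$; and $\mathcal{H}_{nc}(K\wedge k):=\mathcal{H}_{nc}(K)\cap\mathcal{H}_{nc}(k)$ with norm $\|\cdot\|^2_{K\wedge k}:=\|\cdot\|_K^2+\|\cdot\|_k^2$, whose CPNC kernel is denoted $K\wedge k$. For $Z\in\Omega_n$, $K_Z\oplus k_Z$ denotes the map $A\mapsto K_Z(A)\oplus k_Z(A)$ on $\mathbb{C}^{n\times n}$, and similarly for $K_Z\oplus-k_Z$, $K_Z\oplus0$, $0\oplus-k_Z$. *)

theory Defs
  imports Complex_Main "Jordan_Normal_Form.Schur_Decomposition"
begin

hide_const (open) Multiset.mult Polynomial.smult

section \<open>Complex Hilbert spaces on a carrier\<close>

record 'a ip_space = "(complex, 'a) module" +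
  ip :: "'a \<Rightarrow> 'a \<Rightarrow> complex"

definition hnorm :: "('a, 'm) ip_space_scheme \<Rightarrow> 'a \<Rightarrow> real" where
  "hnorm H x = sqrt (Re (ip H x x))"

text \<open>The inner product is linear in the second argument and conjugate-linear in the first.\<close>

locale hilbert_space = vectorspace "class_ring :: complex ring" H
  for H :: "('a, 'm) ip_space_scheme" +
  assumes ip_commute: "\<lbrakk>x \<in> carrier H; y \<in> carrier H\<rbrakk> \<Longrightarrow> ip H x y = cnj (ip H y x)"
    and ip_add_right: "\<lbrakk>x \<in> carrier H; y \<in> carrier H; z \<in> carrier H\<rbrakk>
      \<Longrightarrow> ip H x (y \<oplus>\<^bsub>H\<^esub> z) = ip H x y + ip H x z"
    and ip_smult_right: "\<lbrakk>x \<in> carrier H; y \<in> carrier H\<rbrakk>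
      \<Longrightarrow> ip H x (a \<odot>\<^bsub>H\<^esub> y) = a * ip H x y"
    and ip_nonneg: "x \<in> carrier H \<Longrightarrow> 0 \<le> Re (ip H x x)"
    and ip_definite: "\<lbrakk>x \<in> carrier H; ip H x x = 0\<rbrakk> \<Longrightarrow> x = \<zero>\<^bsub>H\<^esub>"
    and complete: "\<And>s :: nat \<Rightarrow> 'a. \<lbrakk>\<And>n. s n \<in> carrier H;
        \<forall>e>0. \<exists>N. \<forall>m\<ge>N. \<forall>n\<ge>N. hnorm H (s m \<ominus>\<^bsub>H\<^esub> s n) < e\<rbrakk>
      \<Longrightarrow> \<exists>l\<in>carrier H. (\<lambda>n. hnorm H (s n \<ominus>\<^bsub>H\<^esub> l)) \<longlonglongrightarrow> 0"

definition bounded_operator ::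
  "('a, 'm) ip_space_scheme \<Rightarrow> ('b, 'l) ip_space_scheme \<Rightarrow> ('a \<Rightarrow> 'b) \<Rightarrow> bool" where
  "bounded_operator V W T \<longleftrightarrow> linear_map class_ring V W T \<and>
     (\<exists>c. \<forall>x\<in>carrier V. hnorm W (T x) \<le> c * hnorm V x)"

definition isometry ::
  "('a, 'm) ip_space_scheme \<Rightarrow> ('b, 'l) ip_space_scheme \<Rightarrow> ('a \<Rightarrow> 'b) \<Rightarrow> bool" where
  "isometry V W T \<longleftrightarrow> linear_map class_ring V W T \<and>
     (\<forall>x\<in>carrier V. hnorm W (T x) = hnorm V x)"

definition adjoint ::
  "('a, 'm) ip_space_scheme \<Rightarrow> ('b, 'l) ip_space_scheme \<Rightarrow> ('a \<Rightarrow> 'b) \<Rightarrow> 'b \<Rightarrow> 'a" where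
  "adjoint V W T y =
     (THE x. x \<in> carrier V \<and> (\<forall>u\<in>carrier V. ip V x u = ip W y (T u)))"

definition hilbert_sum ::
  "('a, 'm) ip_space_scheme \<Rightarrow> ('b, 'l) ip_space_scheme \<Rightarrow> ('a \<times> 'b) ip_space" where
  "hilbert_sum V W = module.extend (direct_sum V W)
     (ip_space.fields (\<lambda>x y. ip V (fst x) (fst y) + ip W (snd x) (snd y)))"

definition orthogonal_direct_sum ::
  "('a, 'm) ip_space_scheme \<Rightarrow> 'a set \<Rightarrow> 'a set \<Rightarrow> bool" where
  "orthogonal_direct_sum H M N \<longleftrightarrow>
     VectorSpace.subspace class_ring M H \<and> VectorSpace.subspace class_ring N H \<and>
     (\<forall>x\<in>M. \<forall>y\<in>N. ip H x y = 0) \<and> carrier H = {x \<oplus>\<^bsub>H\<^esub> y | x y. x \<in> M \<and> y \<in> N}"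

definition mat_trace :: "complex mat \<Rightarrow> complex" where
  "mat_trace A = (\<Sum>i<dim_row A. A $$ (i, i))"

definition mat_hilbert :: "nat \<Rightarrow> complex mat ip_space" where
  "mat_hilbert n = module.extend (module_mat TYPE(complex) n n)
     (ip_space.fields (\<lambda>A B. mat_trace (mat_adjoint A * B)))"

section \<open>NC sets and free NC functions\<close>

text \<open>A point is a tuple of square matrices of a common size, stored as a list.\<close>

type_synonym nc_point = "complex mat list"
type_synonym nc_fun = "nc_point \<Rightarrow> complex mat"
type_synonym nc_kernel = "nc_point \<Rightarrow> nc_point \<Rightarrow> complex mat \<Rightarrow> complex mat"

definition level :: "nc_point \<Rightarrow> nat" where
  "level Z = dim_row (hd Z)"

definition mat_direct_sum :: "complex mat \<Rightarrow> complex mat \<Rightarrow> complex mat" where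
  "mat_direct_sum A B =
     four_block_mat A (0\<^sub>m (dim_row A) (dim_col B)) (0\<^sub>m (dim_row B) (dim_col A)) B"

definition nc_set :: "nat \<Rightarrow> nc_point set \<Rightarrow> bool" where
  "nc_set d \<Omega> \<longleftrightarrow>
     (\<forall>Z\<in>\<Omega>. length Z = d \<and> (\<exists>n\<ge>1. set Z \<subseteq> carrier_mat n n)) \<and>
     (\<forall>Z\<in>\<Omega>. \<forall>W\<in>\<Omega>. map2 mat_direct_sum Z W \<in> \<Omega>)"

definition free_nc_fun :: "nc_point set \<Rightarrow> nc_fun \<Rightarrow> bool" where
  "free_nc_fun \<Omega> f \<longleftrightarrow> f \<in> extensional \<Omega> \<and>
     (\<forall>Z\<in>\<Omega>. f Z \<in> carrier_mat (level Z) (level Z)) \<and>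
     (\<forall>Z\<in>\<Omega>. \<forall>W\<in>\<Omega>. f (map2 mat_direct_sum Z W) = mat_direct_sum (f Z) (f W)) \<and>
     (\<forall>Z\<in>\<Omega>. \<forall>S\<in>carrier_mat (level Z) (level Z). \<forall>T\<in>carrier_mat (level Z) (level Z).
        inverts_mat S T \<and> inverts_mat T S \<and> map (\<lambda>A. T * A * S) Z \<in> \<Omega> \<longrightarrow>
        f (map (\<lambda>A. T * A * S) Z) = T * f Z * S)"

section \<open>NC reproducing kernel Hilbert spaces\<close>

text \<open>The space of functions on \<open>\<Omega>\<close> with carrier \<open>C\<close>, the pointwise operations and the
  inner product \<open>p\<close>.  All fields that carry no information (the ring multiplication and unit,
  and the inner product off \<open>C\<close>) get fixed values, so that two such spaces with the same
  elements and the same inner product are equal as records.\<close>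

definition nc_fun_space ::
  "nc_point set \<Rightarrow> nc_fun set \<Rightarrow> (nc_fun \<Rightarrow> nc_fun \<Rightarrow> complex) \<Rightarrow> nc_fun ip_space" where
  "nc_fun_space \<Omega> C p =
    \<lparr>carrier = C,
     mult = (\<lambda>f g. \<lambda>Z\<in>\<Omega>. 0\<^sub>m (level Z) (level Z)),
     one = (\<lambda>Z\<in>\<Omega>. 0\<^sub>m (level Z) (level Z)),
     zero = (\<lambda>Z\<in>\<Omega>. 0\<^sub>m (level Z) (level Z)),
     add = (\<lambda>f g. \<lambda>Z\<in>\<Omega>. f Z + g Z),
     smult = (\<lambda>a f. \<lambda>Z\<in>\<Omega>. a \<cdot>\<^sub>m f Z),
     ip = (\<lambda>f g. if f \<in> C \<and> g \<in> C then p f g else 0)\<rparr>"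

definition nc_rkhs :: "nc_point set \<Rightarrow> nc_fun ip_space \<Rightarrow> bool" where
  "nc_rkhs \<Omega> H \<longleftrightarrow> H = nc_fun_space \<Omega> (carrier H) (ip H) \<and> hilbert_space H \<and>
     (\<forall>f\<in>carrier H. free_nc_fun \<Omega> f) \<and>
     (\<forall>Z\<in>\<Omega>. bounded_operator H (mat_hilbert (level Z)) (\<lambda>f. f Z))"

definition point_kernel_map :: "nc_fun ip_space \<Rightarrow> nc_point \<Rightarrow> complex mat \<Rightarrow> nc_fun" where
  "point_kernel_map H Z = adjoint H (mat_hilbert (level Z)) (\<lambda>f. f Z)"

text \<open>\<open>outer_prod v u\<close> is the rank-one matrix \<open>v u\<^sup>*\<close>; below, \<open>M *\<^sub>v x \<bullet>c y\<close> is
  \<open>y\<^sup>* M x\<close>.\<close>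

definition outer_prod :: "complex vec \<Rightarrow> complex vec \<Rightarrow> complex mat" where
  "outer_prod v u = mat (dim_vec v) (dim_vec u) (\<lambda>(i, j). v $ i * cnj (u $ j))"

definition kernel_at ::
  "nc_fun ip_space \<Rightarrow> nc_point \<Rightarrow> nc_point \<Rightarrow> (complex mat \<Rightarrow> complex mat) \<Rightarrow> bool" where
  "kernel_at H Z W L \<longleftrightarrow>
     linear_map class_ring (module_mat TYPE(complex) (level Z) (level W))
       (module_mat TYPE(complex) (level Z) (level W)) L \<and>
     (\<forall>y\<in>carrier_vec (level Z). \<forall>v\<in>carrier_vec (level Z).
      \<forall>x\<in>carrier_vec (level W). \<forall>u\<in>carrier_vec (level W).
        (L (outer_prod v u) *\<^sub>v x) \<bullet>c y =
        ip H (point_kernel_map H Z (outer_prod y v)) (point_kernel_map H W (outer_prod x u)))"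

text \<open>\<open>K\<close> is the kernel of the NC-RKHS \<open>H\<close> on \<open>\<Omega>\<close>.  The values of \<open>K Z W P\<close> for
  \<open>Z\<close> or \<open>W\<close> outside \<open>\<Omega>\<close>, or for \<open>P\<close> of the wrong size, are irrelevant.\<close>

definition kernel_of :: "nc_point set \<Rightarrow> nc_fun ip_space \<Rightarrow> nc_kernel \<Rightarrow> bool" where
  "kernel_of \<Omega> H K \<longleftrightarrow> (\<forall>Z\<in>\<Omega>. \<forall>W\<in>\<Omega>. kernel_at H Z W (K Z W))"

definition cpnc_kernel :: "nc_point set \<Rightarrow> nc_kernel \<Rightarrow> bool" where
  "cpnc_kernel \<Omega> K \<longleftrightarrow> (\<exists>H. nc_rkhs \<Omega> H \<and> kernel_of \<Omega> H K)"

definition Hnc :: "nc_point set \<Rightarrow> nc_kernel \<Rightarrow> nc_fun ip_space" where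
  "Hnc \<Omega> K = (THE H. nc_rkhs \<Omega> H \<and> kernel_of \<Omega> H K)"

definition kernel_map :: "nc_point set \<Rightarrow> nc_kernel \<Rightarrow> nc_point \<Rightarrow> complex mat \<Rightarrow> nc_fun" where
  "kernel_map \<Omega> K Z = point_kernel_map (Hnc \<Omega> K) Z"

section \<open>Join and meet of kernels\<close>

definition kernel_join :: "nc_kernel \<Rightarrow> nc_kernel \<Rightarrow> nc_kernel" where
  "kernel_join K k = (\<lambda>Z W P. K Z W P + k Z W P)"

text \<open>By polarisation, the norm with square \<open>\<parallel>h\<parallel>\<^sub>K\<^sup>2 + \<parallel>h\<parallel>\<^sub>k\<^sup>2\<close> comes from
  the sum of the two inner products.\<close>

definition meet_space :: "nc_point set \<Rightarrow> nc_kernel \<Rightarrow> nc_kernel \<Rightarrow> nc_fun ip_space" where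
  "meet_space \<Omega> K k = nc_fun_space \<Omega> (carrier (Hnc \<Omega> K) \<inter> carrier (Hnc \<Omega> k))
     (\<lambda>f g. ip (Hnc \<Omega> K) f g + ip (Hnc \<Omega> k) f g)"

text \<open>The choice only concerns the irrelevant values of the kernel.\<close>

definition kernel_meet :: "nc_point set \<Rightarrow> nc_kernel \<Rightarrow> nc_kernel \<Rightarrow> nc_kernel" where
  "kernel_meet \<Omega> K k = (SOME J. kernel_of \<Omega> (meet_space \<Omega> K k) J)"

definition sum_space ::
  "nc_point set \<Rightarrow> nc_kernel \<Rightarrow> nc_kernel \<Rightarrow> (nc_fun \<times> nc_fun) ip_space" where
  "sum_space \<Omega> K k = hilbert_sum (Hnc \<Omega> K) (Hnc \<Omega> k)"

definition is_U_join ::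
  "nc_point set \<Rightarrow> nc_kernel \<Rightarrow> nc_kernel \<Rightarrow> (nc_fun \<Rightarrow> nc_fun \<times> nc_fun) \<Rightarrow> bool" where
  "is_U_join \<Omega> K k U \<longleftrightarrow>
     U \<in> extensional (carrier (Hnc \<Omega> (kernel_join K k))) \<and>
     isometry (Hnc \<Omega> (kernel_join K k)) (sum_space \<Omega> K k) U \<and>
     (\<forall>Z\<in>\<Omega>. \<forall>A\<in>carrier_mat (level Z) (level Z).
        U (kernel_map \<Omega> (kernel_join K k) Z A) = (kernel_map \<Omega> K Z A, kernel_map \<Omega> k Z A))"

definition U_join ::
  "nc_point set \<Rightarrow> nc_kernel \<Rightarrow> nc_kernel \<Rightarrow> nc_fun \<Rightarrow> nc_fun \<times> nc_fun" where
  "U_join \<Omega> K k = (THE U. is_U_join \<Omega> K k U)"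

definition U_meet ::
  "nc_point set \<Rightarrow> nc_kernel \<Rightarrow> nc_kernel \<Rightarrow> nc_fun \<Rightarrow> nc_fun \<times> nc_fun" where
  "U_meet \<Omega> K k = (\<lambda>h. (h, \<ominus>\<^bsub>Hnc \<Omega> k\<^esub> h))"

definition U_meet_adj ::
  "nc_point set \<Rightarrow> nc_kernel \<Rightarrow> nc_kernel \<Rightarrow> nc_fun \<times> nc_fun \<Rightarrow> nc_fun" where
  "U_meet_adj \<Omega> K k =
     adjoint (Hnc \<Omega> (kernel_meet \<Omega> K k)) (sum_space \<Omega> K k) (U_meet \<Omega> K k)"

end

theory Submission
  imports Defs
begin

text \<open>Let \<open>S\<close> be the Hilbert sum of the spaces of \<open>K\<close> and \<open>k\<close>, and let \<open>\<Sigma> (f, g) = f + g\<close> pointwise.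
  The kernel of \<open>\<Sigma>\<close> is \<open>{(h, -h)}\<close>, the range of \<open>U_meet\<close>; it is closed because evaluations are
  bounded.  On its orthogonal complement \<open>\<Sigma>\<close> is injective, so the inner product of \<open>S\<close> can be carried
  over to the image, which becomes an NC-RKHS.  By the reproducing property each pair
  \<open>(K\<^sub>Z A, k\<^sub>Z A)\<close> lies in that complement and represents \<open>\<langle>A, (\<Sigma> x)(Z)\<rangle>\<close>; hence the image has the
  kernel \<open>K + k\<close>, \<open>U_join\<close> inverts \<open>\<Sigma>\<close>, and the orthogonal decomposition is the projection theorem.
  The formulas for the meet kernel only restate its reproducing property.  That an NC-RKHS is
  determined by its kernel, and \<open>U_join\<close> by its values on kernel functions, follows because a
  function orthogonal to all kernel functions vanishes.\<close>

section \<open>Projections and Riesz representation on a carrier\<close>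

text \<open>\<open>Hnc\<close>, \<open>adjoint\<close> and \<open>U_join\<close> are definite
  descriptions and \<open>kernel_meet\<close> is a choice, so each assertion first needs existence,
  and mostly uniqueness, of the object it names. Hence the detour through Riesz representation, a
  kernel for an arbitrary NC-RKHS, and uniqueness as equality of records, which
  \<open>nc_fun_space\<close> makes possible by fixing all fields that carry no information.

  Describing the join as all sums f + g with the infimum norm would leave its inner product to be
  found. Choosing the preimage orthogonal to the kernel of the sum map turns it into an inner
  product of pairs. The meet comes from the same transport, along the first projection on the pairs
  (h, -h), so completeness is proved once, for a closed subspace of a Hilbert space.

  Kernels are prescribed on rank-one matrices only. Matrix units are of rank one and read off single
  entries, so values, bounds and limits are compared entry by entry.\<close>

text \<open>Over \<open>class_ring\<close> the scalar operations are those of the complex numbers,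
  so the axioms can be asked in plain arithmetic. The multiple by -1 serves as the additive inverse,
  for which the record has no field.\<close>

lemma complex_vectorspaceI:
  fixes V :: "(complex, 'a, 'm) module_scheme"
  assumes zero: "\<zero>\<^bsub>V\<^esub> \<in> carrier V"
    and add: "\<And>x y. \<lbrakk>x \<in> carrier V; y \<in> carrier V\<rbrakk> \<Longrightarrow> x \<oplus>\<^bsub>V\<^esub> y \<in> carrier V"
    and smult: "\<And>a x. x \<in> carrier V \<Longrightarrow> a \<odot>\<^bsub>V\<^esub> x \<in> carrier V"
    and assoc: "\<And>x y z. \<lbrakk>x \<in> carrier V; y \<in> carrier V; z \<in> carrier V\<rbrakk>
      \<Longrightarrow> (x \<oplus>\<^bsub>V\<^esub> y) \<oplus>\<^bsub>V\<^esub> z = x \<oplus>\<^bsub>V\<^esub> (y \<oplus>\<^bsub>V\<^esub> z)"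
    and comm: "\<And>x y. \<lbrakk>x \<in> carrier V; y \<in> carrier V\<rbrakk> \<Longrightarrow> x \<oplus>\<^bsub>V\<^esub> y = y \<oplus>\<^bsub>V\<^esub> x"
    and l_zero: "\<And>x. x \<in> carrier V \<Longrightarrow> \<zero>\<^bsub>V\<^esub> \<oplus>\<^bsub>V\<^esub> x = x"
    and l_neg: "\<And>x. x \<in> carrier V \<Longrightarrow> (-1) \<odot>\<^bsub>V\<^esub> x \<oplus>\<^bsub>V\<^esub> x = \<zero>\<^bsub>V\<^esub>"
    and l_distr: "\<And>a b x. x \<in> carrier V \<Longrightarrow> (a + b) \<odot>\<^bsub>V\<^esub> x = a \<odot>\<^bsub>V\<^esub> x \<oplus>\<^bsub>V\<^esub> b \<odot>\<^bsub>V\<^esub> x"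
    and r_distr: "\<And>a x y. \<lbrakk>x \<in> carrier V; y \<in> carrier V\<rbrakk>
      \<Longrightarrow> a \<odot>\<^bsub>V\<^esub> (x \<oplus>\<^bsub>V\<^esub> y) = a \<odot>\<^bsub>V\<^esub> x \<oplus>\<^bsub>V\<^esub> a \<odot>\<^bsub>V\<^esub> y"
    and smult_assoc: "\<And>a b x. x \<in> carrier V \<Longrightarrow> (a * b) \<odot>\<^bsub>V\<^esub> x = a \<odot>\<^bsub>V\<^esub> (b \<odot>\<^bsub>V\<^esub> x)"
    and one: "\<And>x. x \<in> carrier V \<Longrightarrow> 1 \<odot>\<^bsub>V\<^esub> x = x"
  shows "vectorspace class_ring V"
proof -
  have "abelian_group V"
    by (rule abelian_groupI) (use assms in \<open>blast+\<close>)
  then have "Module.module class_ring V"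
    by (intro Module.moduleI class_cring.is_cring)
      (use assms in \<open>simp_all add: class_ring_simps\<close>)
  then show ?thesis
    by (simp add: vectorspace_def class_field)
qed

lemma complex_linear_mapI:
  fixes V :: "(complex, 'a, 'm) module_scheme" and W :: "(complex, 'b, 'l) module_scheme"
  assumes "vectorspace class_ring V" "vectorspace class_ring W"
    and "\<And>x. x \<in> carrier V \<Longrightarrow> T x \<in> carrier W"
    and "\<And>x y. \<lbrakk>x \<in> carrier V; y \<in> carrier V\<rbrakk> \<Longrightarrow> T (x \<oplus>\<^bsub>V\<^esub> y) = T x \<oplus>\<^bsub>W\<^esub> T y"
    and "\<And>a x. x \<in> carrier V \<Longrightarrow> T (a \<odot>\<^bsub>V\<^esub> x) = a \<odot>\<^bsub>W\<^esub> T x"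
  shows "linear_map class_ring V W T"
proof -
  have "Module.module class_ring V" "Module.module class_ring W"
    using assms by (simp_all add: vectorspace_def)
  then have "mod_hom class_ring V W T"
    using assms by (auto simp: mod_hom_def mod_hom_axioms_def LinearCombinations.module_hom_def class_ring_simps)
  then show ?thesis using assms by (intro linear_map.intro)
qed

lemma complex_linear_mapD:
  fixes V :: "(complex, 'a, 'm) module_scheme" and W :: "(complex, 'b, 'l) module_scheme"
  assumes "linear_map class_ring V W T"
  shows "vectorspace class_ring V" "vectorspace class_ring W"
    and "\<And>x. x \<in> carrier V \<Longrightarrow> T x \<in> carrier W"
    and "\<And>x y. \<lbrakk>x \<in> carrier V; y \<in> carrier V\<rbrakk> \<Longrightarrow> T (x \<oplus>\<^bsub>V\<^esub> y) = T x \<oplus>\<^bsub>W\<^esub> T y"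
    and "\<And>a x. x \<in> carrier V \<Longrightarrow> T (a \<odot>\<^bsub>V\<^esub> x) = a \<odot>\<^bsub>W\<^esub> T x"
  using assms by (auto simp: linear_map_def mod_hom_def mod_hom_axioms_def LinearCombinations.module_hom_def class_ring_simps)

lemma complex_subspaceI:
  fixes V :: "(complex, 'a, 'm) module_scheme"
  assumes "vectorspace class_ring V" "M \<subseteq> carrier V" "\<zero>\<^bsub>V\<^esub> \<in> M"
    and "\<And>x y. \<lbrakk>x \<in> M; y \<in> M\<rbrakk> \<Longrightarrow> x \<oplus>\<^bsub>V\<^esub> y \<in> M"
    and "\<And>a x. x \<in> M \<Longrightarrow> a \<odot>\<^bsub>V\<^esub> x \<in> M"
  shows "VectorSpace.subspace class_ring M V"
  using assms by (auto simp: VectorSpace.subspace_def LinearCombinations.submodule_def vectorspace_def)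

lemma complex_subspaceD:
  fixes V :: "(complex, 'a, 'm) module_scheme"
  assumes "VectorSpace.subspace class_ring M V"
  shows "M \<subseteq> carrier V" "\<zero>\<^bsub>V\<^esub> \<in> M"
    and "\<And>x y. \<lbrakk>x \<in> M; y \<in> M\<rbrakk> \<Longrightarrow> x \<oplus>\<^bsub>V\<^esub> y \<in> M"
    and "\<And>a x. x \<in> M \<Longrightarrow> a \<odot>\<^bsub>V\<^esub> x \<in> M"
  using assms by (auto simp: VectorSpace.subspace_def LinearCombinations.submodule_def class_ring_simps)

text \<open>Names the limit statement in the axiom \<open>complete\<close>. Closedness of a subspace
  is expressed through it, by sequences.\<close>

definition converges_to :: "('a, 'm) ip_space_scheme \<Rightarrow> (nat \<Rightarrow> 'a) \<Rightarrow> 'a \<Rightarrow> bool" where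
  "converges_to H s l \<longleftrightarrow> (\<lambda>n. hnorm H (s n \<ominus>\<^bsub>H\<^esub> l)) \<longlonglongrightarrow> 0"

lemma null_sequence_comparison:
  fixes f :: "nat \<Rightarrow> 'a :: real_normed_vector"
  assumes "\<And>n. norm (f n) \<le> g n" "g \<longlonglongrightarrow> 0"
  shows "f \<longlonglongrightarrow> 0"
  by (rule tendsto_0_le[OF assms(2), where K = 1])
    (use assms(1) in \<open>auto intro!: always_eventually order_trans[OF _ abs_ge_self]\<close>)

section \<open>Arithmetic of the inner product and the norm\<close>

context hilbert_space
begin

lemma smult_in [simp, intro]: "x \<in> carrier H \<Longrightarrow> a \<odot>\<^bsub>H\<^esub> x \<in> carrier H"
  by (simp add: class_ring_simps)

lemma neg_eq_smult: "x \<in> carrier H \<Longrightarrow> \<ominus>\<^bsub>H\<^esub> x = (-1) \<odot>\<^bsub>H\<^esub> x"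
  using smult_minus_1_back[of x] by (simp add: class_ring_simps)

lemma zero_eq_smult: "x \<in> carrier H \<Longrightarrow> 0 \<odot>\<^bsub>H\<^esub> x = \<zero>\<^bsub>H\<^esub>"
  using smult_l_null[of x] by (simp add: class_ring_simps)

lemma diff_eq_smult: "\<lbrakk>x \<in> carrier H; y \<in> carrier H\<rbrakk> \<Longrightarrow> x \<ominus>\<^bsub>H\<^esub> y = x \<oplus>\<^bsub>H\<^esub> (-1) \<odot>\<^bsub>H\<^esub> y"
  by (simp add: a_minus_def neg_eq_smult)

lemma ip_add_left:
  assumes "x \<in> carrier H" "y \<in> carrier H" "z \<in> carrier H"
  shows "ip H (x \<oplus>\<^bsub>H\<^esub> y) z = ip H x z + ip H y z"
  using assms ip_commute[of _ z] by (simp add: ip_add_right)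

lemma ip_smult_left:
  assumes "x \<in> carrier H" "y \<in> carrier H"
  shows "ip H (a \<odot>\<^bsub>H\<^esub> x) y = cnj a * ip H x y"
  using assms ip_commute[of _ y] by (simp add: ip_smult_right)

lemma ip_zero_right: "x \<in> carrier H \<Longrightarrow> ip H x \<zero>\<^bsub>H\<^esub> = 0"
  by (metis add_cancel_right_right ip_add_right M.zero_closed M.l_zero)

lemma ip_zero_left: "x \<in> carrier H \<Longrightarrow> ip H \<zero>\<^bsub>H\<^esub> x = 0"
  using ip_commute[of "\<zero>\<^bsub>H\<^esub>" x] by (simp add: ip_zero_right)

lemma ip_neg_right: "\<lbrakk>x \<in> carrier H; y \<in> carrier H\<rbrakk> \<Longrightarrow> ip H x (\<ominus>\<^bsub>H\<^esub> y) = - ip H x y"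
  by (simp add: neg_eq_smult ip_smult_right)

lemma ip_neg_left: "\<lbrakk>x \<in> carrier H; y \<in> carrier H\<rbrakk> \<Longrightarrow> ip H (\<ominus>\<^bsub>H\<^esub> x) y = - ip H x y"
  by (simp add: neg_eq_smult ip_smult_left)

lemma ip_diff_right:
  "\<lbrakk>x \<in> carrier H; y \<in> carrier H; z \<in> carrier H\<rbrakk> \<Longrightarrow> ip H x (y \<ominus>\<^bsub>H\<^esub> z) = ip H x y - ip H x z"
  by (simp add: diff_eq_smult ip_add_right ip_smult_right)

lemma ip_diff_left:
  "\<lbrakk>x \<in> carrier H; y \<in> carrier H; z \<in> carrier H\<rbrakk> \<Longrightarrow> ip H (x \<ominus>\<^bsub>H\<^esub> y) z = ip H x z - ip H y z"
  by (simp add: diff_eq_smult ip_add_left ip_smult_left)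

lemmas ip_simps = ip_add_right ip_smult_right ip_add_left ip_smult_left ip_zero_right ip_zero_left
  ip_neg_right ip_neg_left ip_diff_right ip_diff_left

lemma diff_eq_zero_iff:
  assumes "x \<in> carrier H" "y \<in> carrier H"
  shows "x \<ominus>\<^bsub>H\<^esub> y = \<zero>\<^bsub>H\<^esub> \<longleftrightarrow> x = y"
  using assms by (metis M.minus_unique M.minus_minus M.minus_closed M.r_neg a_minus_def abelian_group.a_inv_closed
     M.abelian_group_axioms M.a_comm)

lemma ip_self: "x \<in> carrier H \<Longrightarrow> ip H x x = complex_of_real ((hnorm H x)\<^sup>2)"
  using ip_commute[of x x] ip_nonneg[of x] by (simp add: hnorm_def complex_eq_iff)

lemma hnorm_sq: "x \<in> carrier H \<Longrightarrow> (hnorm H x)\<^sup>2 = Re (ip H x x)"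
  using ip_nonneg[of x] by (simp add: hnorm_def)

lemma hnorm_nonneg: "x \<in> carrier H \<Longrightarrow> 0 \<le> hnorm H x"
  by (simp add: hnorm_def ip_nonneg)

lemma hnorm_eq_zeroD: "\<lbrakk>x \<in> carrier H; hnorm H x = 0\<rbrakk> \<Longrightarrow> x = \<zero>\<^bsub>H\<^esub>"
  using ip_definite[of x] ip_self[of x] by simp

lemma eqI_diff: "\<lbrakk>x \<in> carrier H; y \<in> carrier H; hnorm H (x \<ominus>\<^bsub>H\<^esub> y) = 0\<rbrakk> \<Longrightarrow> x = y"
  using hnorm_eq_zeroD[of "x \<ominus>\<^bsub>H\<^esub> y"] diff_eq_zero_iff by simp

text \<open>Turns an identity between vectors into identities between complex numbers, which
  \<open>ip_simps\<close> settles. Later rearrangements of vector sums go this way instead of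
  through group laws.\<close>

lemma eqI_ip:
  assumes "x \<in> carrier H" "y \<in> carrier H" "\<And>z. z \<in> carrier H \<Longrightarrow> ip H x z = ip H y z"
  shows "x = y"
  using assms ip_definite[of "x \<ominus>\<^bsub>H\<^esub> y"] diff_eq_zero_iff by (simp add: ip_diff_left)

lemma Cauchy_Schwarz:
  assumes x: "x \<in> carrier H" and y: "y \<in> carrier H"
  shows "cmod (ip H x y) \<le> hnorm H x * hnorm H y"
proof (cases "hnorm H x = 0")
  case True
  then show ?thesis using x y hnorm_eq_zeroD[of x] by (simp add: ip_zero_left)
next
  case False
  define c where "c = ip H x y"
  define r where "r = (hnorm H x)\<^sup>2"
  have r: "r > 0" using False by (simp add: r_def)
  have yx: "ip H y x = cnj c" using ip_commute[of y x] x y by (simp add: c_def)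
  \<comment> \<open>This is r times the component of y orthogonal to x; the factor r avoids a
    division.\<close>
  let ?z = "complex_of_real r \<odot>\<^bsub>H\<^esub> y \<ominus>\<^bsub>H\<^esub> c \<odot>\<^bsub>H\<^esub> x"
  have "ip H ?z ?z = of_real r * of_real r * of_real ((hnorm H y)\<^sup>2) - of_real r * (c * cnj c)"
    using x y yx by (simp add: ip_simps ip_self[of x] ip_self[of y] algebra_simps flip: c_def r_def)
  also have "\<dots> = of_real (r * (r * (hnorm H y)\<^sup>2 - (cmod c)\<^sup>2))"
    by (simp add: complex_norm_square[symmetric] algebra_simps)
  finally have "0 \<le> r * (r * (hnorm H y)\<^sup>2 - (cmod c)\<^sup>2)"
    using ip_nonneg[of ?z] x y by simp
  then have "(cmod c)\<^sup>2 \<le> (hnorm H x * hnorm H y)\<^sup>2"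
    using r by (simp add: zero_le_mult_iff r_def power_mult_distrib)
  then show ?thesis using x y by (simp add: c_def abs_le_square_iff[symmetric] hnorm_nonneg)
qed

lemma hnorm_triangle:
  assumes x: "x \<in> carrier H" and y: "y \<in> carrier H"
  shows "hnorm H (x \<oplus>\<^bsub>H\<^esub> y) \<le> hnorm H x + hnorm H y"
proof -
  have "(hnorm H (x \<oplus>\<^bsub>H\<^esub> y))\<^sup>2 = (hnorm H x)\<^sup>2 + (hnorm H y)\<^sup>2 + 2 * Re (ip H x y)"
    using x y ip_commute[of y x] by (simp add: hnorm_sq ip_simps)
  also have "Re (ip H x y) \<le> hnorm H x * hnorm H y"
    using Cauchy_Schwarz[OF x y] complex_Re_le_cmod order_trans by blast
  finally have "(hnorm H (x \<oplus>\<^bsub>H\<^esub> y))\<^sup>2 \<le> (hnorm H x + hnorm H y)\<^sup>2"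
    by (simp add: power2_sum)
  then show ?thesis using x y hnorm_nonneg by (meson add_nonneg_nonneg power2_le_imp_le)
qed

lemma hnorm_diff_commute:
  assumes "x \<in> carrier H" "y \<in> carrier H"
  shows "hnorm H (x \<ominus>\<^bsub>H\<^esub> y) = hnorm H (y \<ominus>\<^bsub>H\<^esub> x)"
  using assms by (simp add: hnorm_def ip_simps algebra_simps)

lemma hnorm_diff_triangle:
  assumes "x \<in> carrier H" "y \<in> carrier H" "z \<in> carrier H"
  shows "hnorm H (x \<ominus>\<^bsub>H\<^esub> z) \<le> hnorm H (x \<ominus>\<^bsub>H\<^esub> y) + hnorm H (y \<ominus>\<^bsub>H\<^esub> z)"
proof -
  have "x \<ominus>\<^bsub>H\<^esub> z = (x \<ominus>\<^bsub>H\<^esub> y) \<oplus>\<^bsub>H\<^esub> (y \<ominus>\<^bsub>H\<^esub> z)"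
    \<comment> \<open>Pairing both sides with an arbitrary vector makes the telescoping plain
      arithmetic.\<close>
    using assms by (intro eqI_ip) (simp_all add: ip_simps)
  then show ?thesis using hnorm_triangle[of "x \<ominus>\<^bsub>H\<^esub> y" "y \<ominus>\<^bsub>H\<^esub> z"] assms by simp
qed

lemma ip_tendsto:
  assumes s: "\<And>n. s n \<in> carrier H" and l: "l \<in> carrier H" and y: "y \<in> carrier H"
    and conv: "converges_to H s l"
  shows "(\<lambda>n. ip H y (s n)) \<longlonglongrightarrow> ip H y l"
proof -
  have "(\<lambda>n. hnorm H y * hnorm H (s n \<ominus>\<^bsub>H\<^esub> l)) \<longlonglongrightarrow> 0"
    using conv tendsto_mult_right_zero by (auto simp: converges_to_def)
  moreover have "cmod (ip H y (s n) - ip H y l) \<le> hnorm H y * hnorm H (s n \<ominus>\<^bsub>H\<^esub> l)" for n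
    using Cauchy_Schwarz[of y "s n \<ominus>\<^bsub>H\<^esub> l"] s l y by (simp add: ip_diff_right)
  ultimately have "(\<lambda>n. ip H y (s n) - ip H y l) \<longlonglongrightarrow> 0"
    by (rule null_sequence_comparison[rotated])
  then show ?thesis by (simp add: LIM_zero_iff)
qed

text \<open>Used to carry a sequence that converges in one space over to another space that gives
  its differences the same norms.\<close>

lemma converges_to_Cauchy:
  assumes s: "\<And>n. s n \<in> carrier H" and l: "l \<in> carrier H" and conv: "converges_to H s l"
  shows "\<forall>e>0. \<exists>N. \<forall>m\<ge>N. \<forall>n\<ge>N. hnorm H (s m \<ominus>\<^bsub>H\<^esub> s n) < e"
proof (intro allI impI)
  fix e :: real assume "e > 0"
  then obtain N where N: "\<And>n. n \<ge> N \<Longrightarrow> hnorm H (s n \<ominus>\<^bsub>H\<^esub> l) < e / 2"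
    using conv[unfolded converges_to_def LIMSEQ_iff] by (metis half_gt_zero diff_zero abs_ge_self order_le_less_trans real_norm_def)
  have "hnorm H (s m \<ominus>\<^bsub>H\<^esub> s n) < e" if "m \<ge> N" "n \<ge> N" for m n
    using hnorm_diff_triangle[of "s m" l "s n"] hnorm_diff_commute[of l "s n"] N[OF that(1)] N[OF that(2)] s l
    by simp
  then show "\<exists>N. \<forall>m\<ge>N. \<forall>n\<ge>N. hnorm H (s m \<ominus>\<^bsub>H\<^esub> s n) < e" by blast
qed

text \<open>\<open>M\<close> need not be closed, so the projection \<open>p\<close> of \<open>x\<close> is only a limit of elements of \<open>M\<close>.\<close>

lemma projection_onto_closure:
  assumes M: "VectorSpace.subspace class_ring M H" and x: "x \<in> carrier H"
  obtains p s where "p \<in> carrier H" "\<And>n. s n \<in> M" "converges_to H s p"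
    "\<And>m. m \<in> M \<Longrightarrow> ip H m (x \<ominus>\<^bsub>H\<^esub> p) = 0"
proof -
  note MD = complex_subspaceD[OF M]
  have MH: "m \<in> carrier H" if "m \<in> M" for m using MD(1) that by blast
  define q where "q m = (hnorm H (x \<ominus>\<^bsub>H\<^esub> m))\<^sup>2" for m
  define \<delta> where "\<delta> = Inf (q ` M)"
  have bdd: "bdd_below (q ` M)" by (rule bdd_belowI[of _ 0]) (auto simp: q_def)
  have ne: "q ` M \<noteq> {}" using MD(2) by blast
  have \<delta>_le: "\<delta> \<le> q m" if "m \<in> M" for m
    unfolding \<delta>_def using bdd that by (intro cInf_lower) auto
  have "\<exists>m\<in>M. q m < \<delta> + inverse (real (Suc n))" for n
    using cInf_lessD[OF ne, of "\<delta> + inverse (real (Suc n))"] by (auto simp: \<delta>_def)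
  then obtain s where sM: "\<And>n. s n \<in> M" and s: "\<And>n. q (s n) < \<delta> + inverse (real (Suc n))"
    by metis
  have sH: "s n \<in> carrier H" for n using sM MH by blast
  \<comment> \<open>Parallelogram law for the vectors from x to \<open>s m\<close> and
    \<open>s n\<close>: the midpoint \<open>?h\<close> lies in M, so its squared distance to x is at
    least the infimum, and only the two excesses remain.\<close>
  have par: "(hnorm H (s m \<ominus>\<^bsub>H\<^esub> s n))\<^sup>2 \<le> 2 * inverse (real (Suc m)) + 2 * inverse (real (Suc n))" for m n
  proof -
    let ?h = "(1/2) \<odot>\<^bsub>H\<^esub> (s m \<oplus>\<^bsub>H\<^esub> s n)"
    have "(hnorm H (s m \<ominus>\<^bsub>H\<^esub> s n))\<^sup>2 = 2 * q (s m) + 2 * q (s n) - 4 * q ?h"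
      using sH x by (simp add: q_def hnorm_sq ip_simps field_simps)
    moreover have "\<delta> \<le> q ?h" using sM MD by (intro \<delta>_le) blast
    ultimately show ?thesis using s[of m] s[of n] by linarith
  qed
  have "\<forall>e>0. \<exists>N. \<forall>m\<ge>N. \<forall>n\<ge>N. hnorm H (s m \<ominus>\<^bsub>H\<^esub> s n) < e"
  proof (intro allI impI)
    fix e :: real assume e: "e > 0"
    \<comment> \<open>Each index contributes at most 2/(N+1), hence the quarter of the
      square.\<close>
    then obtain N where N: "inverse (real (Suc N)) < e\<^sup>2 / 4"
      using reals_Archimedean[of "e\<^sup>2 / 4"] by auto
    have "hnorm H (s m \<ominus>\<^bsub>H\<^esub> s n) < e" if "m \<ge> N" "n \<ge> N" for m n
    proof -
      have "inverse (real (Suc m)) \<le> inverse (real (Suc N))" "inverse (real (Suc n)) \<le> inverse (real (Suc N))"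
        using that by (simp_all add: le_imp_inverse_le)
      then have "(hnorm H (s m \<ominus>\<^bsub>H\<^esub> s n))\<^sup>2 < e\<^sup>2" using par[of m n] N by linarith
      then show ?thesis using e by (simp add: power_less_imp_less_base)
    qed
    then show "\<exists>N. \<forall>m\<ge>N. \<forall>n\<ge>N. hnorm H (s m \<ominus>\<^bsub>H\<^esub> s n) < e" by blast
  qed
  then obtain p where p: "p \<in> carrier H" and conv: "converges_to H s p"
    using complete[of s] sH unfolding converges_to_def by blast
  have "ip H m (x \<ominus>\<^bsub>H\<^esub> p) = 0" if m: "m \<in> M" for m
  proof (cases "hnorm H m = 0")
    case True
    then show ?thesis using hnorm_eq_zeroD[of m] MH[OF m] x p by (simp add: ip_zero_left)
  next
    case False
    have mH: "m \<in> carrier H" using m MH by blast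
    define r where "r = (hnorm H m)\<^sup>2"
    have r: "r > 0" using False by (simp add: r_def)
    define c where "c n = ip H m (x \<ominus>\<^bsub>H\<^esub> s n)" for n
    have c_le: "(cmod (c n))\<^sup>2 \<le> r * inverse (real (Suc n))" for n
    proof -
      \<comment> \<open>The multiple of m closest to w. Subtracting it lowers the squared distance
        by exactly |c n|^2 / r, and since \<open>s n\<close> exceeds the infimum by less than
        1/(n+1), the gain cannot be larger than that.\<close>
      let ?a = "c n / of_real r"
      define w where "w = x \<ominus>\<^bsub>H\<^esub> s n"
      let ?z = "w \<ominus>\<^bsub>H\<^esub> ?a \<odot>\<^bsub>H\<^esub> m"
      have wH: "w \<in> carrier H" using x sH by (simp add: w_def)
      have wm: "ip H w m = cnj (c n)" using ip_commute[OF wH mH] by (simp add: c_def w_def)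
      have mw: "ip H m w = c n" by (simp add: c_def w_def)
      have "ip H ?z ?z = ip H w w - c n * cnj (c n) / of_real r"
        using wH mH r by (simp add: ip_diff_left ip_diff_right ip_smult_left ip_smult_right
           wm mw ip_self[of m] flip: r_def)
      then have "(hnorm H ?z)\<^sup>2 = q (s n) - (cmod (c n))\<^sup>2 / r"
        using wH mH by (simp add: hnorm_sq q_def complex_norm_square[symmetric] flip: w_def)
      moreover have "?z = x \<ominus>\<^bsub>H\<^esub> (s n \<oplus>\<^bsub>H\<^esub> ?a \<odot>\<^bsub>H\<^esub> m)"
        using x sH mH by (intro eqI_ip) (simp_all add: ip_simps w_def)
      moreover have "\<delta> \<le> q (s n \<oplus>\<^bsub>H\<^esub> ?a \<odot>\<^bsub>H\<^esub> m)" using sM m MD by (intro \<delta>_le) blast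
      ultimately have "(cmod (c n))\<^sup>2 / r \<le> inverse (real (Suc n))"
        using s[of n] by (simp add: q_def)
      then show ?thesis using r by (simp add: field_simps)
    qed
    have "(\<lambda>n. r * inverse (real (Suc n))) \<longlonglongrightarrow> 0"
      using tendsto_mult_right_zero LIMSEQ_inverse_real_of_nat by blast
    then have "(\<lambda>n. (cmod (c n))\<^sup>2) \<longlonglongrightarrow> 0"
      by (rule null_sequence_comparison[rotated]) (use c_le in auto)
    then have "c \<longlonglongrightarrow> 0"
      by (simp add: tendsto_norm_zero_iff)
    moreover have "c \<longlonglongrightarrow> ip H m x - ip H m p"
      unfolding c_def using x sH mH p conv
      by (simp add: ip_diff_right) (intro tendsto_intros ip_tendsto)
    ultimately have "ip H m x - ip H m p = 0" using LIMSEQ_unique by blast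
    then show ?thesis using mH x p by (simp add: ip_diff_right)
  qed
  then show ?thesis using that p sM conv by blast
qed

text \<open>The difference between x and its projection is orthogonal to M, hence zero, so the
  sequence that approximates the projection approximates x.\<close>

lemma dense_if_orthogonal_trivial:
  assumes M: "VectorSpace.subspace class_ring M H" and x: "x \<in> carrier H"
    and triv: "\<And>y. \<lbrakk>y \<in> carrier H; \<And>m. m \<in> M \<Longrightarrow> ip H m y = 0\<rbrakk> \<Longrightarrow> y = \<zero>\<^bsub>H\<^esub>"
  obtains s where "\<And>n. s n \<in> M" "converges_to H s x"
proof -
  obtain p s where p: "p \<in> carrier H" "\<And>n. s n \<in> M" "converges_to H s p"
    "\<And>m. m \<in> M \<Longrightarrow> ip H m (x \<ominus>\<^bsub>H\<^esub> p) = 0"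
    using projection_onto_closure[OF M x] by metis
  have "x \<ominus>\<^bsub>H\<^esub> p = \<zero>\<^bsub>H\<^esub>" using x p by (intro triv) simp_all
  then have "x = p" using diff_eq_zero_iff x p by blast
  then show ?thesis using p that by blast
qed

theorem Riesz_representation:
  fixes \<phi> :: "'a \<Rightarrow> complex"
  assumes add: "\<And>x y. \<lbrakk>x \<in> carrier H; y \<in> carrier H\<rbrakk> \<Longrightarrow> \<phi> (x \<oplus>\<^bsub>H\<^esub> y) = \<phi> x + \<phi> y"
    and smult: "\<And>a x. x \<in> carrier H \<Longrightarrow> \<phi> (a \<odot>\<^bsub>H\<^esub> x) = a * \<phi> x"
    and bound: "\<And>x. x \<in> carrier H \<Longrightarrow> cmod (\<phi> x) \<le> c * hnorm H x"
  obtains z where "z \<in> carrier H" "\<And>x. x \<in> carrier H \<Longrightarrow> \<phi> x = ip H z x"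
proof (cases "\<forall>x\<in>carrier H. \<phi> x = 0")
  case True
  then show ?thesis by (intro that[of "\<zero>\<^bsub>H\<^esub>"]) (simp_all add: ip_zero_left)
next
  case False
  then obtain x0 where x0: "x0 \<in> carrier H" "\<phi> x0 \<noteq> 0" by blast
  have diff: "\<phi> (x \<ominus>\<^bsub>H\<^esub> y) = \<phi> x - \<phi> y" if "x \<in> carrier H" "y \<in> carrier H" for x y
    using that by (simp add: diff_eq_smult add smult)
  define M where "M = {x \<in> carrier H. \<phi> x = 0}"
  have "\<phi> \<zero>\<^bsub>H\<^esub> = 0" using smult[of "\<zero>\<^bsub>H\<^esub>" 0] by (simp add: zero_eq_smult)
  then have M: "VectorSpace.subspace class_ring M H"
    by (intro complex_subspaceI vectorspace_axioms) (auto simp: M_def add smult)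
  obtain p s where p: "p \<in> carrier H" "\<And>n. s n \<in> M" "converges_to H s p"
    "\<And>m. m \<in> M \<Longrightarrow> ip H m (x0 \<ominus>\<^bsub>H\<^esub> p) = 0"
    using projection_onto_closure[OF M x0(1)] by metis
  \<comment> \<open>The projection p is only a limit of elements of the kernel of
    \<open>\<phi>\<close>; boundedness of \<open>\<phi>\<close> is what gives
    \<open>\<phi> p = 0\<close>.\<close>
  have "(\<lambda>n. c * hnorm H (s n \<ominus>\<^bsub>H\<^esub> p)) \<longlonglongrightarrow> 0"
    using p(3) tendsto_mult_right_zero by (auto simp: converges_to_def)
  moreover have "cmod (\<phi> p) \<le> c * hnorm H (s n \<ominus>\<^bsub>H\<^esub> p)" for n
    using bound[of "s n \<ominus>\<^bsub>H\<^esub> p"] p(1) p(2)[of n] by (simp add: diff M_def)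
  ultimately have "cmod (\<phi> p) \<le> 0"
    by (meson LIMSEQ_le_const)
  then have \<phi>p: "\<phi> p = 0" by simp
  define w where "w = x0 \<ominus>\<^bsub>H\<^esub> p"
  have wH: "w \<in> carrier H" using x0 p by (simp add: w_def)
  have \<phi>w: "\<phi> w \<noteq> 0" using x0 p \<phi>p by (simp add: w_def diff)
  have "\<phi> \<zero>\<^bsub>H\<^esub> = 0" by fact
  then have ww: "ip H w w \<noteq> 0" using ip_definite[OF wH] \<phi>w by auto
  show ?thesis
  proof (rule that[of "cnj (\<phi> w / ip H w w) \<odot>\<^bsub>H\<^esub> w"])
    show "cnj (\<phi> w / ip H w w) \<odot>\<^bsub>H\<^esub> w \<in> carrier H" using wH by simp
    fix x assume x: "x \<in> carrier H"
    \<comment> \<open>\<open>\<phi>\<close> vanishes on this combination, so it is orthogonal to w,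
      which forces the coefficient of the representer. The conjugate there undoes the
      conjugate-linearity of the first argument.\<close>
    let ?m = "\<phi> w \<odot>\<^bsub>H\<^esub> x \<ominus>\<^bsub>H\<^esub> \<phi> x \<odot>\<^bsub>H\<^esub> w"
    have "?m \<in> M" using x wH by (simp add: M_def diff smult)
    then have "ip H ?m w = 0" unfolding w_def by (rule p(4))
    then have "ip H w ?m = 0" using ip_commute[of w ?m] x wH by simp
    then have "\<phi> w * ip H w x = \<phi> x * ip H w w" using x wH by (simp add: ip_simps)
    then show "\<phi> x = ip H (cnj (\<phi> w / ip H w w) \<odot>\<^bsub>H\<^esub> w) x"
      using x wH ww by (simp add: ip_smult_left field_simps)
  qed
qed

end

text \<open>Stated for bare vector spaces, because it is applied to spaces whose completeness is
  still being proved.\<close>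

lemma complex_vectorspace_diff:
  fixes V :: "(complex, 'a, 'm) module_scheme"
  assumes "vectorspace class_ring V" "x \<in> carrier V" "y \<in> carrier V"
  shows "x \<ominus>\<^bsub>V\<^esub> y = x \<oplus>\<^bsub>V\<^esub> (-1) \<odot>\<^bsub>V\<^esub> y"
proof -
  interpret vectorspace class_ring V by fact
  show ?thesis using assms smult_minus_1_back[of y] by (simp add: a_minus_def class_ring_simps)
qed

section \<open>Hilbert sums\<close>

lemma hilbert_sum_simps:
  "carrier (hilbert_sum V W) = carrier V \<times> carrier W"
  "\<zero>\<^bsub>hilbert_sum V W\<^esub> = (\<zero>\<^bsub>V\<^esub>, \<zero>\<^bsub>W\<^esub>)"
  "x \<oplus>\<^bsub>hilbert_sum V W\<^esub> y = (fst x \<oplus>\<^bsub>V\<^esub> fst y, snd x \<oplus>\<^bsub>W\<^esub> snd y)"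
  "a \<odot>\<^bsub>hilbert_sum V W\<^esub> x = (a \<odot>\<^bsub>V\<^esub> fst x, a \<odot>\<^bsub>W\<^esub> snd x)"
  "ip (hilbert_sum V W) x y = ip V (fst x) (fst y) + ip W (snd x) (snd y)"
  by (simp_all add: hilbert_sum_def direct_sum_def module.defs ip_space.defs)

lemma hnorm_hilbert_sum:
  assumes "hilbert_space V" "hilbert_space W" "x \<in> carrier (hilbert_sum V W)"
  shows "(hnorm (hilbert_sum V W) x)\<^sup>2 = (hnorm V (fst x))\<^sup>2 + (hnorm W (snd x))\<^sup>2"
  using assms hilbert_space.ip_nonneg[OF assms(1)] hilbert_space.ip_nonneg[OF assms(2)]
  by (auto simp: hnorm_def hilbert_sum_simps)

lemma hnorm_hilbert_sum_bounds:
  assumes "hilbert_space V" "hilbert_space W" "x \<in> carrier (hilbert_sum V W)"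
  shows "hnorm V (fst x) \<le> hnorm (hilbert_sum V W) x" "hnorm W (snd x) \<le> hnorm (hilbert_sum V W) x"
    and "hnorm (hilbert_sum V W) x \<le> hnorm V (fst x) + hnorm W (snd x)"
proof -
  have nn: "0 \<le> hnorm V (fst x)" "0 \<le> hnorm W (snd x)" "0 \<le> hnorm (hilbert_sum V W) x"
    using assms hilbert_space.ip_nonneg[OF assms(1)] hilbert_space.ip_nonneg[OF assms(2)]
    by (auto simp: hnorm_def hilbert_sum_simps)
  note sq = hnorm_hilbert_sum[OF assms]
  show "hnorm V (fst x) \<le> hnorm (hilbert_sum V W) x" "hnorm W (snd x) \<le> hnorm (hilbert_sum V W) x"
    by (rule power2_le_imp_le[OF _ nn(3)], simp add: sq)+
  show "hnorm (hilbert_sum V W) x \<le> hnorm V (fst x) + hnorm W (snd x)"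
    by (rule power2_le_imp_le) (simp_all add: power2_sum sq nn)
qed

lemma hilbert_sum_vectorspace:
  assumes "hilbert_space V" "hilbert_space W"
  shows "vectorspace class_ring (hilbert_sum V W)"
proof -
  interpret V: hilbert_space V by fact
  interpret W: hilbert_space W by fact
  show ?thesis
    by (rule complex_vectorspaceI)
      (auto simp: hilbert_sum_simps V.M.a_ac W.M.a_ac V.M.r_neg W.M.r_neg
        V.M.l_zero W.M.l_zero V.neg_eq_smult[symmetric] W.neg_eq_smult[symmetric]
        V.smult_l_distr[simplified class_ring_simps] W.smult_l_distr[simplified class_ring_simps]
        V.smult_r_distr[simplified class_ring_simps] W.smult_r_distr[simplified class_ring_simps]
        V.smult_assoc1[simplified class_ring_simps] W.smult_assoc1[simplified class_ring_simps]
        V.smult_one[simplified class_ring_simps] W.smult_one[simplified class_ring_simps])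
qed

lemma hilbert_sum_diff:
  assumes "hilbert_space V" "hilbert_space W"
    "x \<in> carrier (hilbert_sum V W)" "y \<in> carrier (hilbert_sum V W)"
  shows "x \<ominus>\<^bsub>hilbert_sum V W\<^esub> y = (fst x \<ominus>\<^bsub>V\<^esub> fst y, snd x \<ominus>\<^bsub>W\<^esub> snd y)"
proof -
  interpret V: hilbert_space V by fact
  interpret W: hilbert_space W by fact
  show ?thesis using assms(3,4)
    by (subst complex_vectorspace_diff[OF hilbert_sum_vectorspace[OF assms(1,2)]])
      (auto simp: hilbert_sum_simps V.diff_eq_smult W.diff_eq_smult)
qed

text \<open>The norm of a pair lies between each component norm and their sum. Only the summands are
  assumed to be Hilbert spaces, since completeness of the sum rests on this equivalence.\<close>

lemma hilbert_sum_converges_to_iff: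
  assumes V: "hilbert_space V" and W: "hilbert_space W"
    and s: "\<And>n. s n \<in> carrier (hilbert_sum V W)" and l: "l \<in> carrier (hilbert_sum V W)"
  shows "converges_to (hilbert_sum V W) s l \<longleftrightarrow>
    converges_to V (\<lambda>n. fst (s n)) (fst l) \<and> converges_to W (\<lambda>n. snd (s n)) (snd l)"
proof -
  interpret V: hilbert_space V by fact
  interpret W: hilbert_space W by fact
  have fl: "fst l \<in> carrier V" "snd l \<in> carrier W"
    using l by (auto simp: hilbert_sum_simps)
  have fs: "fst (s n) \<in> carrier V" "snd (s n) \<in> carrier W" for n
    using s[of n] by (auto simp: hilbert_sum_simps)
  have d: "s n \<ominus>\<^bsub>hilbert_sum V W\<^esub> l \<in> carrier (hilbert_sum V W)" for n
    using fs[of n] fl hilbert_sum_diff[OF V W s l] by (simp add: hilbert_sum_simps)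
  have eq: "s n \<ominus>\<^bsub>hilbert_sum V W\<^esub> l = (fst (s n) \<ominus>\<^bsub>V\<^esub> fst l, snd (s n) \<ominus>\<^bsub>W\<^esub> snd l)" for n
    using hilbert_sum_diff[OF V W s l] .
  note b = hnorm_hilbert_sum_bounds[OF V W d, unfolded eq fst_conv snd_conv, folded eq]
  show ?thesis
  proof
    assume *: "converges_to (hilbert_sum V W) s l"
    have n: "norm (hnorm V (fst (s n) \<ominus>\<^bsub>V\<^esub> fst l)) \<le> hnorm (hilbert_sum V W) (s n \<ominus>\<^bsub>hilbert_sum V W\<^esub> l)"
      "norm (hnorm W (snd (s n) \<ominus>\<^bsub>W\<^esub> snd l)) \<le> hnorm (hilbert_sum V W) (s n \<ominus>\<^bsub>hilbert_sum V W\<^esub> l)" for n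
      using b(1,2)[of n] fs[of n] fl by (simp_all add: V.hnorm_nonneg W.hnorm_nonneg)
    show "converges_to V (\<lambda>n. fst (s n)) (fst l) \<and> converges_to W (\<lambda>n. snd (s n)) (snd l)"
      using null_sequence_comparison[OF n(1) *[unfolded converges_to_def]]
        null_sequence_comparison[OF n(2) *[unfolded converges_to_def]] by (simp add: converges_to_def)
  next
    assume *: "converges_to V (\<lambda>n. fst (s n)) (fst l) \<and> converges_to W (\<lambda>n. snd (s n)) (snd l)"
    have "norm (hnorm (hilbert_sum V W) (s n \<ominus>\<^bsub>hilbert_sum V W\<^esub> l))
        \<le> hnorm V (fst (s n) \<ominus>\<^bsub>V\<^esub> fst l) + hnorm W (snd (s n) \<ominus>\<^bsub>W\<^esub> snd l)" for n
      using b(1,3)[of n] V.hnorm_nonneg[of "fst (s n) \<ominus>\<^bsub>V\<^esub> fst l"] fs[of n] fl by simp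
    from null_sequence_comparison[OF this] * show "converges_to (hilbert_sum V W) s l"
      by (simp add: converges_to_def tendsto_add_zero)
  qed
qed

lemma hilbert_space_hilbert_sum:
  assumes V: "hilbert_space V" and W: "hilbert_space W"
  shows "hilbert_space (hilbert_sum V W)"
proof -
  interpret V: hilbert_space V by fact
  interpret W: hilbert_space W by fact
  interpret S: vectorspace class_ring "hilbert_sum V W"
    by (rule hilbert_sum_vectorspace[OF V W])
  show ?thesis
  proof
    fix x y assume "x \<in> carrier (hilbert_sum V W)" "y \<in> carrier (hilbert_sum V W)"
    then show "ip (hilbert_sum V W) x y = cnj (ip (hilbert_sum V W) y x)"
      using V.ip_commute[of "fst x" "fst y"] W.ip_commute[of "snd x" "snd y"]
      by (auto simp: hilbert_sum_simps)
  next
    fix x assume x: "x \<in> carrier (hilbert_sum V W)"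
    then have nn: "0 \<le> Re (ip V (fst x) (fst x))" "0 \<le> Re (ip W (snd x) (snd x))"
      using V.ip_nonneg W.ip_nonneg by (auto simp: hilbert_sum_simps)
    then show "0 \<le> Re (ip (hilbert_sum V W) x x)"
      by (simp add: hilbert_sum_simps)
    assume "ip (hilbert_sum V W) x x = 0"
    then have "Re (ip V (fst x) (fst x)) + Re (ip W (snd x) (snd x)) = 0"
      by (metis hilbert_sum_simps(5) plus_complex.sel(1) zero_complex.sel(1))
    then have "Re (ip V (fst x) (fst x)) = 0" "Re (ip W (snd x) (snd x)) = 0" using nn by linarith+
    then show "x = \<zero>\<^bsub>hilbert_sum V W\<^esub>"
      using x V.hnorm_eq_zeroD[of "fst x"] W.hnorm_eq_zeroD[of "snd x"]
      by (auto simp: hilbert_sum_simps hnorm_def)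
  next
    fix s :: "nat \<Rightarrow> _" assume s: "\<And>n. s n \<in> carrier (hilbert_sum V W)"
      and C: "\<forall>e>0. \<exists>N. \<forall>m\<ge>N. \<forall>n\<ge>N. hnorm (hilbert_sum V W) (s m \<ominus>\<^bsub>hilbert_sum V W\<^esub> s n) < e"
    have fs: "fst (s n) \<in> carrier V" "snd (s n) \<in> carrier W" for n
      using s[of n] by (auto simp: hilbert_sum_simps)
    have e: "fst (s m \<ominus>\<^bsub>hilbert_sum V W\<^esub> s n) = fst (s m) \<ominus>\<^bsub>V\<^esub> fst (s n)"
      "snd (s m \<ominus>\<^bsub>hilbert_sum V W\<^esub> s n) = snd (s m) \<ominus>\<^bsub>W\<^esub> snd (s n)" for m n
      using hilbert_sum_diff[OF V W s s] by simp_all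
    note le = hnorm_hilbert_sum_bounds(1,2)[OF V W S.M.minus_closed[OF s s], unfolded e]
    have "\<forall>e>0. \<exists>N. \<forall>m\<ge>N. \<forall>n\<ge>N. hnorm V (fst (s m) \<ominus>\<^bsub>V\<^esub> fst (s n)) < e"
      using C order_le_less_trans[OF le(1)] by blast
    from V.complete[OF fs(1) this] obtain a
      where a: "a \<in> carrier V" "converges_to V (\<lambda>n. fst (s n)) a"
      unfolding converges_to_def by blast
    have "\<forall>e>0. \<exists>N. \<forall>m\<ge>N. \<forall>n\<ge>N. hnorm W (snd (s m) \<ominus>\<^bsub>W\<^esub> snd (s n)) < e"
      using C order_le_less_trans[OF le(2)] by blast
    from W.complete[OF fs(2) this] obtain b
      where b: "b \<in> carrier W" "converges_to W (\<lambda>n. snd (s n)) b"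
      unfolding converges_to_def by blast
    have "converges_to (hilbert_sum V W) s (a, b)"
      using a b s by (subst hilbert_sum_converges_to_iff[OF V W]) (auto simp: hilbert_sum_simps)
    then show "\<exists>l\<in>carrier (hilbert_sum V W). (\<lambda>n. hnorm (hilbert_sum V W) (s n \<ominus>\<^bsub>hilbert_sum V W\<^esub> l)) \<longlonglongrightarrow> 0"
      using a b unfolding converges_to_def by (intro bexI[of _ "(a, b)"]) (auto simp: hilbert_sum_simps)
  next
    fix x y z assume "x \<in> carrier (hilbert_sum V W)" "y \<in> carrier (hilbert_sum V W)" "z \<in> carrier (hilbert_sum V W)"
    then have "fst x \<in> carrier V" "fst y \<in> carrier V" "fst z \<in> carrier V"
      "snd x \<in> carrier W" "snd y \<in> carrier W" "snd z \<in> carrier W"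
      by (auto simp: hilbert_sum_simps)
    then show "ip (hilbert_sum V W) x (y \<oplus>\<^bsub>hilbert_sum V W\<^esub> z) = ip (hilbert_sum V W) x y + ip (hilbert_sum V W) x z"
      by (simp add: hilbert_sum_simps V.ip_add_right W.ip_add_right)
  next
    fix a x y assume "x \<in> carrier (hilbert_sum V W)" "y \<in> carrier (hilbert_sum V W)"
    then show "ip (hilbert_sum V W) x (a \<odot>\<^bsub>hilbert_sum V W\<^esub> y) = a * ip (hilbert_sum V W) x y"
      by (auto simp: hilbert_sum_simps V.ip_smult_right W.ip_smult_right distrib_left)
  qed
qed

section \<open>The trace inner product\<close>

lemma mat_adjoint_carrier: "A \<in> carrier_mat n m \<Longrightarrow> mat_adjoint A \<in> carrier_mat m n"
  by (simp add: mat_adjoint_def mat_of_rows_def)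

lemma mat_adjoint_index:
  fixes A :: "complex mat"
  shows "\<lbrakk>A \<in> carrier_mat n m; i < m; j < n\<rbrakk> \<Longrightarrow> mat_adjoint A $$ (i, j) = cnj (A $$ (j, i))"
  by (simp add: mat_adjoint_def mat_of_rows_def)

lemma mat_hilbert_simps:
  "carrier (mat_hilbert n) = carrier_mat n n"
  "\<zero>\<^bsub>mat_hilbert n\<^esub> = 0\<^sub>m n n"
  "A \<oplus>\<^bsub>mat_hilbert n\<^esub> B = A + B"
  "a \<odot>\<^bsub>mat_hilbert n\<^esub> A = a \<cdot>\<^sub>m A"
  by (simp_all add: mat_hilbert_def module.defs module_mat_simps)

lemma mat_hilbert_ip:
  assumes "A \<in> carrier_mat n n" "B \<in> carrier_mat n n"
  shows "ip (mat_hilbert n) A B = (\<Sum>i<n. \<Sum>j<n. cnj (A $$ (i, j)) * B $$ (i, j))"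
proof -
  have "ip (mat_hilbert n) A B = (\<Sum>j<n. \<Sum>i<n. cnj (A $$ (i, j)) * B $$ (i, j))"
    using assms mat_adjoint_carrier[OF assms(1)]
    by (auto simp: mat_hilbert_def module.defs ip_space.defs mat_trace_def scalar_prod_def
        mat_adjoint_index atLeast0LessThan intro!: sum.cong)
  also have "\<dots> = (\<Sum>i<n. \<Sum>j<n. cnj (A $$ (i, j)) * B $$ (i, j))"
    by (rule sum.swap)
  finally show ?thesis .
qed

lemma mat_hilbert_vectorspace: "vectorspace class_ring (mat_hilbert n)"
proof (rule complex_vectorspaceI)
  fix A assume "A \<in> carrier (mat_hilbert n)"
  then show "(-1) \<odot>\<^bsub>mat_hilbert n\<^esub> A \<oplus>\<^bsub>mat_hilbert n\<^esub> A = \<zero>\<^bsub>mat_hilbert n\<^esub>"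
    by (auto simp: mat_hilbert_simps intro!: eq_matI)
qed (auto simp: mat_hilbert_simps algebra_simps intro!: eq_matI)

lemma hnorm_mat_hilbert:
  assumes "A \<in> carrier_mat n n"
  shows "hnorm (mat_hilbert n) A = sqrt (\<Sum>i<n. \<Sum>j<n. (cmod (A $$ (i, j)))\<^sup>2)"
proof -
  have "Re (cnj z * z) = (cmod z)\<^sup>2" for z
    by (simp add: cmod_power2 flip: power2_eq_square)
  then show ?thesis
    unfolding hnorm_def mat_hilbert_ip[OF assms assms] by (simp add: Re_sum del: times_complex.sel)
qed

lemma mat_entry_le_hnorm:
  assumes "A \<in> carrier_mat n n" "i < n" "j < n"
  shows "cmod (A $$ (i, j)) \<le> hnorm (mat_hilbert n) A"
proof -
  have "(cmod (A $$ (i, j)))\<^sup>2 \<le> (\<Sum>j<n. (cmod (A $$ (i, j)))\<^sup>2)"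
    using assms by (intro member_le_sum) auto
  also have "\<dots> \<le> (\<Sum>i<n. \<Sum>j<n. (cmod (A $$ (i, j)))\<^sup>2)"
    using assms by (intro member_le_sum[where f = "\<lambda>i. \<Sum>j<n. (cmod (A $$ (i, j)))\<^sup>2"]) (auto intro: sum_nonneg)
  finally show ?thesis by (simp add: hnorm_mat_hilbert[OF assms(1)] real_le_rsqrt)
qed

text \<open>The factor n is the square root of the number of entries. Together with
  \<open>mat_entry_le_hnorm\<close> it makes boundedness of an evaluation equivalent to a bound on
  every entry.\<close>

lemma hnorm_mat_le:
  assumes "A \<in> carrier_mat n n" "\<And>i j. \<lbrakk>i < n; j < n\<rbrakk> \<Longrightarrow> cmod (A $$ (i, j)) \<le> b" "0 \<le> b"
  shows "hnorm (mat_hilbert n) A \<le> real n * b"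
proof -
  have "(\<Sum>i<n. \<Sum>j<n. (cmod (A $$ (i, j)))\<^sup>2) \<le> (\<Sum>i<n. \<Sum>j<n. b\<^sup>2)"
    using assms by (intro sum_mono power_mono) auto
  also have "\<dots> = (real n * b)\<^sup>2" by (simp add: power2_eq_square)
  finally show ?thesis
    using assms(3) by (simp add: hnorm_mat_hilbert[OF assms(1)] real_le_lsqrt sum_nonneg)
qed

lemma outer_prod_carrier [simp]:
  "\<lbrakk>v \<in> carrier_vec n; u \<in> carrier_vec m\<rbrakk> \<Longrightarrow> outer_prod v u \<in> carrier_mat n m"
  by (simp add: outer_prod_def)

lemma outer_prod_index:
  "\<lbrakk>v \<in> carrier_vec n; u \<in> carrier_vec m; i < n; j < m\<rbrakk>
    \<Longrightarrow> outer_prod v u $$ (i, j) = v $ i * cnj (u $ j)"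
  by (simp add: outer_prod_def)

lemma sesquilinear_eq_sum:
  fixes A :: "complex mat"
  assumes "A \<in> carrier_mat n m" "x \<in> carrier_vec m" "y \<in> carrier_vec n"
  shows "(A *\<^sub>v x) \<bullet>c y = (\<Sum>i<n. cnj (y $ i) * (\<Sum>j<m. A $$ (i, j) * x $ j))"
  using assms by (auto simp: scalar_prod_def atLeast0LessThan mult.commute intro!: sum.cong)

lemma mat_hilbert_ip_outer_prod:
  assumes "A \<in> carrier_mat n n" "y \<in> carrier_vec n" "v \<in> carrier_vec n"
  shows "ip (mat_hilbert n) (outer_prod y v) A = (A *\<^sub>v v) \<bullet>c y"
  using assms by (simp add: mat_hilbert_ip[of _ n] sesquilinear_eq_sum[of _ n n] outer_prod_index[of _ n _ n]
      sum_distrib_left mult_ac)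

lemma sesquilinear_unit_vec:
  fixes A :: "complex mat"
  assumes "A \<in> carrier_mat n m" "i < n" "j < m"
  shows "(A *\<^sub>v unit_vec m j) \<bullet>c unit_vec n i = A $$ (i, j)"
proof -
  have "A $$ (a, b) * unit_vec m j $ b = (if b = j then A $$ (a, b) else 0)" if "b < m" for a b
    using that assms by simp
  moreover have "cnj (unit_vec n i $ a) * z = (if a = i then z else 0)" if "a < n" for a z
    using that assms by simp
  ultimately show ?thesis
    using assms by (simp add: sesquilinear_eq_sum[of _ n m] del: index_unit_vec cong: sum.cong_simp)
qed

section \<open>NC-RKHS and their kernels\<close>

lemma nc_fun_space_simps:
  "carrier (nc_fun_space \<Omega> C p) = C"
  "\<zero>\<^bsub>nc_fun_space \<Omega> C p\<^esub> = (\<lambda>Z\<in>\<Omega>. 0\<^sub>m (level Z) (level Z))"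
  "f \<oplus>\<^bsub>nc_fun_space \<Omega> C p\<^esub> g = (\<lambda>Z\<in>\<Omega>. f Z + g Z)"
  "a \<odot>\<^bsub>nc_fun_space \<Omega> C p\<^esub> f = (\<lambda>Z\<in>\<Omega>. a \<cdot>\<^sub>m f Z)"
  "ip (nc_fun_space \<Omega> C p) f g = (if f \<in> C \<and> g \<in> C then p f g else 0)"
  by (simp_all add: nc_fun_space_def)

text \<open>The inner product field is 0 off the carrier, so agreement on the carrier already gives
  equal records. Uniqueness of a space can therefore be an equation.\<close>

lemma nc_fun_space_cong:
  assumes "\<And>f g. \<lbrakk>f \<in> C; g \<in> C\<rbrakk> \<Longrightarrow> p f g = q f g"
  shows "nc_fun_space \<Omega> C p = nc_fun_space \<Omega> C q"
  using assms by (auto simp: nc_fun_space_def fun_eq_iff)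

lemma free_nc_fun_carrier:
  "\<lbrakk>free_nc_fun \<Omega> f; Z \<in> \<Omega>\<rbrakk> \<Longrightarrow> f Z \<in> carrier_mat (level Z) (level Z)"
  by (simp add: free_nc_fun_def)

lemma free_nc_fun_ext:
  assumes f: "free_nc_fun \<Omega> f" and g: "free_nc_fun \<Omega> g"
    and eq: "\<And>Z i j. \<lbrakk>Z \<in> \<Omega>; i < level Z; j < level Z\<rbrakk> \<Longrightarrow> f Z $$ (i, j) = g Z $$ (i, j)"
  shows "f = g"
proof (rule extensionalityI[of _ \<Omega>])
  show "f \<in> extensional \<Omega>" "g \<in> extensional \<Omega>"
    using f g by (simp_all add: free_nc_fun_def)
  show "f Z = g Z" if "Z \<in> \<Omega>" for Z
    using free_nc_fun_carrier[OF f that] free_nc_fun_carrier[OF g that] eq[OF that]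
    by (intro eq_matI) auto
qed

lemma mat_direct_sum_add:
  assumes "A \<in> carrier_mat n n" "A' \<in> carrier_mat n n" "B \<in> carrier_mat m m" "B' \<in> carrier_mat m m"
  shows "mat_direct_sum A B + mat_direct_sum A' B' = mat_direct_sum (A + A') (B + B')"
proof -
  have "mat_direct_sum A B = four_block_mat A (0\<^sub>m n m) (0\<^sub>m m n) B"
    "mat_direct_sum A' B' = four_block_mat A' (0\<^sub>m n m) (0\<^sub>m m n) B'"
    "mat_direct_sum (A + A') (B + B') = four_block_mat (A + A') (0\<^sub>m n m) (0\<^sub>m m n) (B + B')"
    using assms by (simp_all add: mat_direct_sum_def)
  then show ?thesis
    using assms by (simp add: add_four_block_mat[of _ n n _ m _ m])
qed

lemma free_nc_fun_add:
  assumes \<Omega>: "nc_set d \<Omega>" and f: "free_nc_fun \<Omega> f" and g: "free_nc_fun \<Omega> g"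
  shows "free_nc_fun \<Omega> (\<lambda>Z\<in>\<Omega>. f Z + g Z)"
  unfolding free_nc_fun_def
proof (intro conjI ballI impI)
  note c = free_nc_fun_carrier[OF f] free_nc_fun_carrier[OF g]
  fix Z assume Z: "Z \<in> \<Omega>"
  show "(\<lambda>Z\<in>\<Omega>. f Z + g Z) Z \<in> carrier_mat (level Z) (level Z)"
    using c Z by simp
  fix W assume W: "W \<in> \<Omega>"
  \<comment> \<open>Closure of \<Omega> under direct sums puts this point in the domain of the
    restricted function, so its value there is the sum and not \<open>undefined\<close>.\<close>
  have "map2 mat_direct_sum Z W \<in> \<Omega>"
    using \<Omega> Z W by (simp add: nc_set_def)
  then show "(\<lambda>Z\<in>\<Omega>. f Z + g Z) (map2 mat_direct_sum Z W)
      = mat_direct_sum ((\<lambda>Z\<in>\<Omega>. f Z + g Z) Z) ((\<lambda>Z\<in>\<Omega>. f Z + g Z) W)"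
    using Z W f g mat_direct_sum_add[OF c(1)[OF Z] c(2)[OF Z] c(1)[OF W] c(2)[OF W]]
    by (simp add: free_nc_fun_def)
next
  note c = free_nc_fun_carrier[OF f] free_nc_fun_carrier[OF g]
  fix Z S T assume Z: "Z \<in> \<Omega>" and ST: "S \<in> carrier_mat (level Z) (level Z)" "T \<in> carrier_mat (level Z) (level Z)"
    and inv: "inverts_mat S T \<and> inverts_mat T S \<and> map (\<lambda>A. T * A * S) Z \<in> \<Omega>"
  have "T * (f Z + g Z) * S = T * f Z * S + T * g Z * S"
    using ST c[OF Z] by (simp add: mult_add_distrib_mat[of _ "level Z" "level Z"]
        add_mult_distrib_mat[of _ "level Z" "level Z"])
  then show "(\<lambda>Z\<in>\<Omega>. f Z + g Z) (map (\<lambda>A. T * A * S) Z) = T * (\<lambda>Z\<in>\<Omega>. f Z + g Z) Z * S"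
    using Z ST inv f g by (simp add: free_nc_fun_def)
qed simp

lemma nc_fun_space_vectorspace:
  assumes free: "\<And>f. f \<in> C \<Longrightarrow> free_nc_fun \<Omega> f"
    and zero: "(\<lambda>Z\<in>\<Omega>. 0\<^sub>m (level Z) (level Z)) \<in> C"
    and add: "\<And>f g. \<lbrakk>f \<in> C; g \<in> C\<rbrakk> \<Longrightarrow> (\<lambda>Z\<in>\<Omega>. f Z + g Z) \<in> C"
    and smult: "\<And>a f. f \<in> C \<Longrightarrow> (\<lambda>Z\<in>\<Omega>. a \<cdot>\<^sub>m f Z) \<in> C"
  shows "vectorspace class_ring (nc_fun_space \<Omega> C p)"
proof -
  have c: "f Z \<in> carrier_mat (level Z) (level Z)" if "f \<in> C" "Z \<in> \<Omega>" for f Z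
    using free_nc_fun_carrier[OF free] that by blast
  have d: "dim_row (f Z) = level Z" "dim_col (f Z) = level Z" if "f \<in> C" "Z \<in> \<Omega>" for f Z
    using c[OF that] by auto
  have e: "f \<in> extensional \<Omega>" if "f \<in> C" for f
    using free[OF that] by (simp add: free_nc_fun_def)
  show ?thesis
  proof (rule complex_vectorspaceI, unfold nc_fun_space_simps)
    fix f g h :: nc_fun and a b :: complex
    show "(\<lambda>Z\<in>\<Omega>. 0\<^sub>m (level Z) (level Z)) \<in> C" by fact
    assume f: "f \<in> C"
    show "(\<lambda>Z\<in>\<Omega>. a \<cdot>\<^sub>m f Z) \<in> C" using smult f by blast
    show "(\<lambda>Z\<in>\<Omega>. (\<lambda>Z\<in>\<Omega>. 0\<^sub>m (level Z) (level Z)) Z + f Z) = f"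
      "(\<lambda>Z\<in>\<Omega>. 1 \<cdot>\<^sub>m f Z) = f"
      using c[OF f] e[OF f] by (auto intro!: extensionalityI[of _ \<Omega>])
    show "(\<lambda>Z\<in>\<Omega>. (\<lambda>Z\<in>\<Omega>. (-1) \<cdot>\<^sub>m f Z) Z + f Z) = (\<lambda>Z\<in>\<Omega>. 0\<^sub>m (level Z) (level Z))"
      using d[OF f] by (auto intro!: restrict_ext eq_matI)
    show "(\<lambda>Z\<in>\<Omega>. (a + b) \<cdot>\<^sub>m f Z) = (\<lambda>Z\<in>\<Omega>. (\<lambda>Z\<in>\<Omega>. a \<cdot>\<^sub>m f Z) Z + (\<lambda>Z\<in>\<Omega>. b \<cdot>\<^sub>m f Z) Z)"
      "(\<lambda>Z\<in>\<Omega>. (a * b) \<cdot>\<^sub>m f Z) = (\<lambda>Z\<in>\<Omega>. a \<cdot>\<^sub>m (\<lambda>Z\<in>\<Omega>. b \<cdot>\<^sub>m f Z) Z)"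
      using d[OF f] by (auto intro!: restrict_ext eq_matI simp: distrib_right)
    assume g: "g \<in> C"
    show "(\<lambda>Z\<in>\<Omega>. f Z + g Z) \<in> C" using add f g by blast
    show "(\<lambda>Z\<in>\<Omega>. f Z + g Z) = (\<lambda>Z\<in>\<Omega>. g Z + f Z)"
      using d[OF f] d[OF g] by (auto intro!: restrict_ext eq_matI simp: add.commute)
    show "(\<lambda>Z\<in>\<Omega>. a \<cdot>\<^sub>m (\<lambda>Z\<in>\<Omega>. f Z + g Z) Z) = (\<lambda>Z\<in>\<Omega>. (\<lambda>Z\<in>\<Omega>. a \<cdot>\<^sub>m f Z) Z + (\<lambda>Z\<in>\<Omega>. a \<cdot>\<^sub>m g Z) Z)"
      using d[OF f] d[OF g] by (auto intro!: restrict_ext eq_matI simp: distrib_left)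
    assume h: "h \<in> C"
    show "(\<lambda>Z\<in>\<Omega>. (\<lambda>Z\<in>\<Omega>. f Z + g Z) Z + h Z) = (\<lambda>Z\<in>\<Omega>. f Z + (\<lambda>Z\<in>\<Omega>. g Z + h Z) Z)"
      using c[OF f] c[OF g] c[OF h] by (auto intro!: restrict_ext assoc_add_mat)
  qed
qed

text \<open>An explicit candidate supplies existence for the definite description, and nondegeneracy
  of the inner product supplies uniqueness. Every adjoint below is computed by exhibiting its
  value.\<close>

lemma (in hilbert_space) adjoint_eqI:
  assumes "x \<in> carrier H" "\<And>u. u \<in> carrier H \<Longrightarrow> ip H x u = ip W y (T u)"
  shows "adjoint H W T y = x"
  unfolding adjoint_def
proof (rule the_equality)
  fix z assume "z \<in> carrier H \<and> (\<forall>u\<in>carrier H. ip H z u = ip W y (T u))"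
  then show "z = x" using assms by (intro eqI_ip) simp_all
qed (use assms in blast)

lemma nc_rkhsI:
  assumes H: "H = nc_fun_space \<Omega> C p" and hilbert: "hilbert_space H"
    and free: "\<And>f. f \<in> C \<Longrightarrow> free_nc_fun \<Omega> f"
    and bound: "\<And>Z. Z \<in> \<Omega> \<Longrightarrow>
      \<exists>c. \<forall>f\<in>C. \<forall>i<level Z. \<forall>j<level Z. cmod (f Z $$ (i, j)) \<le> c * hnorm H f"
  shows "nc_rkhs \<Omega> H"
  unfolding nc_rkhs_def
proof (intro conjI ballI)
  interpret hilbert_space H by fact
  have C: "carrier H = C" by (simp add: H nc_fun_space_simps)
  \<comment> \<open>\<open>p\<close> is arbitrary off C, where it may differ from
    \<open>ip H\<close>; \<open>nc_fun_space_cong\<close> ignores these values.\<close>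
  have "ip H f g = p f g" if "f \<in> C" "g \<in> C" for f g
    using that by (simp add: H nc_fun_space_simps)
  then show "H = nc_fun_space \<Omega> (carrier H) (ip H)"
    unfolding C by (subst H) (rule nc_fun_space_cong, simp)
  show "hilbert_space H" by fact
  show "free_nc_fun \<Omega> f" if "f \<in> carrier H" for f
    using that free C by blast
  fix Z assume Z: "Z \<in> \<Omega>"
  have c: "f Z \<in> carrier_mat (level Z) (level Z)" if "f \<in> C" for f
    using free_nc_fun_carrier[OF free[OF that] Z] .
  have lin: "linear_map class_ring H (mat_hilbert (level Z)) (\<lambda>f. f Z)"
    using Z c C by (intro complex_linear_mapI vectorspace_axioms mat_hilbert_vectorspace)
      (simp_all add: H nc_fun_space_simps mat_hilbert_simps)
  obtain b where b: "\<And>f i j. \<lbrakk>f \<in> C; i < level Z; j < level Z\<rbrakk> \<Longrightarrow> cmod (f Z $$ (i, j)) \<le> b * hnorm H f"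
    using bound[OF Z] by blast
  \<comment> \<open>The bound b comes with no sign, whereas \<open>hnorm_mat_le\<close> asks for a
    nonnegative one; hence its absolute value.\<close>
  have "hnorm (mat_hilbert (level Z)) (f Z) \<le> real (level Z) * \<bar>b\<bar> * hnorm H f" if f: "f \<in> C" for f
  proof -
    have nn: "0 \<le> hnorm H f" using hnorm_nonneg f C by simp
    then have "b * hnorm H f \<le> \<bar>b\<bar> * hnorm H f" by (intro mult_right_mono) auto
    then show ?thesis
      using hnorm_mat_le[OF c[OF f], of "\<bar>b\<bar> * hnorm H f"] b[OF f] nn
      by (simp add: mult.assoc) (meson order_trans)
  qed
  then show "bounded_operator H (mat_hilbert (level Z)) (\<lambda>f. f Z)"
    using lin C unfolding bounded_operator_def by blast
qed

section \<open>The reproducing property in a single NC-RKHS\<close>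

locale nc_rkhs_space = hilbert_space H for H :: "nc_fun ip_space" +
  fixes \<Omega> :: "nc_point set"
  assumes rkhs: "nc_rkhs \<Omega> H"

lemma nc_rkhs_spaceI: "nc_rkhs \<Omega> H \<Longrightarrow> nc_rkhs_space H \<Omega>"
  by (simp add: nc_rkhs_space_def nc_rkhs_space_axioms_def nc_rkhs_def)

context nc_rkhs_space
begin

lemma space_eq: "H = nc_fun_space \<Omega> (carrier H) (ip H)"
  using rkhs by (simp add: nc_rkhs_def)

lemma free: "f \<in> carrier H \<Longrightarrow> free_nc_fun \<Omega> f"
  using rkhs by (simp add: nc_rkhs_def)

lemma value_carrier: "\<lbrakk>f \<in> carrier H; Z \<in> \<Omega>\<rbrakk> \<Longrightarrow> f Z \<in> carrier_mat (level Z) (level Z)"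
  using free free_nc_fun_carrier by blast

lemma zero_fun: "\<zero>\<^bsub>H\<^esub> = (\<lambda>Z\<in>\<Omega>. 0\<^sub>m (level Z) (level Z))"
  by (subst space_eq) (simp add: nc_fun_space_simps)

lemma add_fun: "f \<oplus>\<^bsub>H\<^esub> g = (\<lambda>Z\<in>\<Omega>. f Z + g Z)"
  by (subst space_eq) (simp add: nc_fun_space_simps)

lemma smult_fun: "a \<odot>\<^bsub>H\<^esub> f = (\<lambda>Z\<in>\<Omega>. a \<cdot>\<^sub>m f Z)"
  by (subst space_eq) (simp add: nc_fun_space_simps)

lemma neg_fun: "f \<in> carrier H \<Longrightarrow> \<ominus>\<^bsub>H\<^esub> f = (\<lambda>Z\<in>\<Omega>. (-1) \<cdot>\<^sub>m f Z)"
  by (simp add: neg_eq_smult smult_fun)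

lemma diff_fun:
  assumes "f \<in> carrier H" "g \<in> carrier H"
  shows "f \<ominus>\<^bsub>H\<^esub> g = (\<lambda>Z\<in>\<Omega>. f Z + (-1) \<cdot>\<^sub>m g Z)"
  using assms by (simp add: diff_eq_smult smult_fun add_fun cong: restrict_cong)

lemma bounded_entries:
  assumes Z: "Z \<in> \<Omega>"
  obtains c where "0 \<le> c"
    "\<And>f i j. \<lbrakk>f \<in> carrier H; i < level Z; j < level Z\<rbrakk> \<Longrightarrow> cmod (f Z $$ (i, j)) \<le> c * hnorm H f"
proof -
  have "bounded_operator H (mat_hilbert (level Z)) (\<lambda>f. f Z)"
    using rkhs Z by (simp add: nc_rkhs_def)
  then obtain b where b: "\<And>f. f \<in> carrier H \<Longrightarrow> hnorm (mat_hilbert (level Z)) (f Z) \<le> b * hnorm H f"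
    unfolding bounded_operator_def by blast
  show thesis
  proof (rule that[of "\<bar>b\<bar>"])
    fix f i j assume f: "f \<in> carrier H" and ij: "i < level Z" "j < level Z"
    have "cmod (f Z $$ (i, j)) \<le> b * hnorm H f"
      using mat_entry_le_hnorm[OF value_carrier[OF f Z] ij] b[OF f] by linarith
    also have "\<dots> \<le> \<bar>b\<bar> * hnorm H f"
      using hnorm_nonneg[OF f] by (intro mult_right_mono) auto
    finally show "cmod (f Z $$ (i, j)) \<le> \<bar>b\<bar> * hnorm H f" .
  qed simp
qed

text \<open>Bounded evaluation makes f \<mapsto> <A, f(Z)> a bounded linear functional, and its
  Riesz representer is the value that the definite description \<open>adjoint\<close> asks
  for.\<close>

lemma point_kernel_map:
  assumes Z: "Z \<in> \<Omega>" and A: "A \<in> carrier_mat (level Z) (level Z)"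
  shows "point_kernel_map H Z A \<in> carrier H"
    and "f \<in> carrier H \<Longrightarrow> ip H (point_kernel_map H Z A) f = ip (mat_hilbert (level Z)) A (f Z)"
proof -
  let ?n = "level Z"
  define \<phi> where "\<phi> f = (\<Sum>i<?n. \<Sum>j<?n. cnj (A $$ (i, j)) * f Z $$ (i, j))" for f :: nc_fun
  have \<phi>: "ip (mat_hilbert ?n) A (f Z) = \<phi> f" if "f \<in> carrier H" for f
    unfolding \<phi>_def by (rule mat_hilbert_ip[OF A value_carrier[OF that Z]])
  obtain c where c: "0 \<le> c"
    "\<And>f i j. \<lbrakk>f \<in> carrier H; i < ?n; j < ?n\<rbrakk> \<Longrightarrow> cmod (f Z $$ (i, j)) \<le> c * hnorm H f"
    using bounded_entries[OF Z] by metis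
  have add: "\<phi> (f \<oplus>\<^bsub>H\<^esub> g) = \<phi> f + \<phi> g" if "f \<in> carrier H" "g \<in> carrier H" for f g
    using value_carrier[OF that(1) Z] value_carrier[OF that(2) Z] Z
    by (simp add: \<phi>_def add_fun distrib_left sum.distrib)
  have smult: "\<phi> (a \<odot>\<^bsub>H\<^esub> f) = a * \<phi> f" if "f \<in> carrier H" for a f
    using value_carrier[OF that Z] Z by (simp add: \<phi>_def smult_fun sum_distrib_left mult.left_commute)
  have bound: "cmod (\<phi> f) \<le> (\<Sum>i<?n. \<Sum>j<?n. cmod (A $$ (i, j)) * c) * hnorm H f" if "f \<in> carrier H" for f
  proof -
    have "cmod (\<phi> f) \<le> (\<Sum>i<?n. \<Sum>j<?n. cmod (cnj (A $$ (i, j)) * f Z $$ (i, j)))"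
      unfolding \<phi>_def by (intro order_trans[OF norm_sum] sum_mono order_refl)
    also have "\<dots> \<le> (\<Sum>i<?n. \<Sum>j<?n. cmod (A $$ (i, j)) * (c * hnorm H f))"
      unfolding norm_mult complex_mod_cnj by (intro sum_mono mult_left_mono) (use c that in auto)
    finally show ?thesis by (simp add: sum_distrib_right mult.assoc)
  qed
  obtain z where z: "z \<in> carrier H" "\<And>f. f \<in> carrier H \<Longrightarrow> \<phi> f = ip H z f"
    using Riesz_representation[of \<phi>, OF add smult bound] by metis
  have "point_kernel_map H Z A = z"
    unfolding point_kernel_map_def using z by (intro adjoint_eqI) (simp_all add: \<phi>)
  then show "point_kernel_map H Z A \<in> carrier H"
    "f \<in> carrier H \<Longrightarrow> ip H (point_kernel_map H Z A) f = ip (mat_hilbert ?n) A (f Z)"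
    using z by (simp_all add: \<phi>)
qed

lemma point_kernel_map_eqI:
  assumes "x \<in> carrier H" "\<And>f. f \<in> carrier H \<Longrightarrow> ip H x f = ip (mat_hilbert (level Z)) A (f Z)"
  shows "point_kernel_map H Z A = x"
  unfolding point_kernel_map_def using assms by (intro adjoint_eqI)

lemma ip_kernel_outer_prod:
  assumes "Z \<in> \<Omega>" "y \<in> carrier_vec (level Z)" "v \<in> carrier_vec (level Z)" "f \<in> carrier H"
  shows "ip H (point_kernel_map H Z (outer_prod y v)) f = (f Z *\<^sub>v v) \<bullet>c y"
  using assms by (simp add: point_kernel_map mat_hilbert_ip_outer_prod[of _ "level Z"] value_carrier)

text \<open>Matrix units turn each entry of a value into an inner product with a fixed vector.
  Everything entrywise below rests on this.\<close>

lemma ip_kernel_unit: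
  assumes "Z \<in> \<Omega>" "i < level Z" "j < level Z" "f \<in> carrier H"
  shows "ip H (point_kernel_map H Z (outer_prod (unit_vec (level Z) i) (unit_vec (level Z) j))) f = f Z $$ (i, j)"
  using assms by (simp add: ip_kernel_outer_prod sesquilinear_unit_vec[of _ "level Z"] value_carrier)

text \<open>An entry is an inner product with a fixed kernel function, hence continuous for the
  norm.\<close>

lemma pointwise_tendsto:
  assumes "\<And>n. s n \<in> carrier H" "l \<in> carrier H" "converges_to H s l" "Z \<in> \<Omega>" "i < level Z" "j < level Z"
  shows "(\<lambda>n. s n Z $$ (i, j)) \<longlonglongrightarrow> l Z $$ (i, j)"
  using ip_tendsto[OF assms(1,2) point_kernel_map(1) assms(3),
      of Z "outer_prod (unit_vec (level Z) i) (unit_vec (level Z) j)"] assms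
  by (simp add: ip_kernel_unit)

text \<open>Rank-one matrices suffice because matrix units are among them. With
  \<open>dense_if_orthogonal_trivial\<close>, every subspace that contains these kernel functions is
  dense.\<close>

lemma zero_if_orthogonal_to_kernels:
  assumes y: "y \<in> carrier H"
    and orth: "\<And>Z x u. \<lbrakk>Z \<in> \<Omega>; x \<in> carrier_vec (level Z); u \<in> carrier_vec (level Z)\<rbrakk>
      \<Longrightarrow> ip H (point_kernel_map H Z (outer_prod x u)) y = 0"
  shows "y = \<zero>\<^bsub>H\<^esub>"
proof (rule free_nc_fun_ext[of \<Omega>])
  fix Z i j assume Z: "Z \<in> \<Omega>" and ij: "i < level Z" "j < level Z"
  have "y Z $$ (i, j) = 0"
    using ip_kernel_unit[OF Z ij y] orth[OF Z] by simp
  then show "y Z $$ (i, j) = \<zero>\<^bsub>H\<^esub> Z $$ (i, j)" using Z ij by (simp add: zero_fun)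
qed (simp_all add: free y)

text \<open>Entry (i, j) at Z is the pairing with the kernel function of a matrix unit at Z, and the
  kernel prescribes that pairing. So the kernel determines the kernel functions as
  functions.\<close>

lemma kernel_values:
  assumes "kernel_at H Z W L" "Z \<in> \<Omega>" "W \<in> \<Omega>" "i < level Z" "j < level Z"
    "x \<in> carrier_vec (level W)" "u \<in> carrier_vec (level W)"
  shows "point_kernel_map H W (outer_prod x u) Z $$ (i, j)
    = (L (outer_prod (unit_vec (level Z) j) u) *\<^sub>v x) \<bullet>c unit_vec (level Z) i"
  using assms by (simp add: kernel_at_def ip_kernel_unit point_kernel_map(1))

text \<open>Gives meaning to the choice in \<open>kernel_meet\<close>, for which only the space is
  known in advance.\<close>

lemma kernel_exists: "\<exists>J. kernel_of \<Omega> H J"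
proof -
  define G where "G Z W a i b j = point_kernel_map H Z
      (outer_prod (unit_vec (level Z) a) (unit_vec (level Z) i)) W $$ (b, j)" for Z W :: nc_point and a i b j
  define J where "J Z W P = mat (level Z) (level W) (\<lambda>(a, b).
      \<Sum>i<level Z. \<Sum>j<level W. P $$ (i, j) * cnj (G Z W a i b j))" for Z W :: nc_point and P
  have "kernel_at H Z W (J Z W)" if Z: "Z \<in> \<Omega>" and W: "W \<in> \<Omega>" for Z W
    unfolding kernel_at_def
  proof (intro conjI ballI)
    let ?n = "level Z" and ?m = "level W"
    show "linear_map class_ring (module_mat TYPE(complex) ?n ?m) (module_mat TYPE(complex) ?n ?m) (J Z W)"
      by (intro complex_linear_mapI matrix_vs)
        (auto simp: module_mat_simps J_def sum.distrib distrib_right sum_distrib_left mult.assoc intro!: eq_matI)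
    fix y v x u :: "complex vec" assume y: "y \<in> carrier_vec ?n" and v: "v \<in> carrier_vec ?n"
      and x: "x \<in> carrier_vec ?m" and u: "u \<in> carrier_vec ?m"
    define F where "F = point_kernel_map H W (outer_prod x u)"
    have F: "F \<in> carrier H" using W x u by (simp add: F_def point_kernel_map)
    \<comment> \<open>Conjugate symmetry moves the evaluation from F at Z to the unit kernel
      function at W, whose entries are the numbers G. This expands F in x and u without a linearity
      law for \<open>point_kernel_map\<close>.\<close>
    have Fai: "F Z $$ (a, i) = (\<Sum>b<?m. \<Sum>j<?m. x $ b * cnj (u $ j) * cnj (G Z W a i b j))"
      if ai: "a < ?n" "i < ?n" for a i
    proof -
      let ?E = "point_kernel_map H Z (outer_prod (unit_vec ?n a) (unit_vec ?n i))"
      have E: "?E \<in> carrier H" using Z by (simp add: point_kernel_map)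
      have "F Z $$ (a, i) = cnj (ip H F ?E)"
        using ip_kernel_unit[OF Z ai F] ip_commute[OF E F] by simp
      also have "ip H F ?E = (\<Sum>b<?m. cnj (x $ b) * (\<Sum>j<?m. G Z W a i b j * u $ j))"
        unfolding F_def using W x u E
        by (simp add: ip_kernel_outer_prod sesquilinear_eq_sum[of _ ?m ?m] value_carrier G_def)
      finally show ?thesis by (simp add: sum_distrib_left mult_ac)
    qed
    have inner: "(\<Sum>i<?n. F Z $$ (a, i) * v $ i) = (\<Sum>b<?m. J Z W (outer_prod v u) $$ (a, b) * x $ b)"
      if a: "a < ?n" for a
    proof -
      have "(\<Sum>i<?n. F Z $$ (a, i) * v $ i)
          = (\<Sum>i<?n. \<Sum>b<?m. \<Sum>j<?m. v $ i * cnj (u $ j) * cnj (G Z W a i b j) * x $ b)"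
        using a by (auto simp: Fai sum_distrib_left mult_ac intro!: sum.cong)
      also have "\<dots> = (\<Sum>b<?m. \<Sum>i<?n. \<Sum>j<?m. v $ i * cnj (u $ j) * cnj (G Z W a i b j) * x $ b)"
        by (rule sum.swap)
      also have "\<dots> = (\<Sum>b<?m. J Z W (outer_prod v u) $$ (a, b) * x $ b)"
        using a u v by (auto simp: J_def outer_prod_index[of _ ?n _ ?m] sum_distrib_right intro!: sum.cong)
      finally show ?thesis .
    qed
    have "ip H (point_kernel_map H Z (outer_prod y v)) F = (F Z *\<^sub>v v) \<bullet>c y"
      using ip_kernel_outer_prod[OF Z y v F] .
    also have "\<dots> = (\<Sum>a<?n. cnj (y $ a) * (\<Sum>i<?n. F Z $$ (a, i) * v $ i))"
      by (rule sesquilinear_eq_sum[OF value_carrier[OF F Z] v y])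
    also have "\<dots> = (\<Sum>a<?n. cnj (y $ a) * (\<Sum>b<?m. J Z W (outer_prod v u) $$ (a, b) * x $ b))"
      by (intro sum.cong refl) (simp add: inner)
    also have "\<dots> = (J Z W (outer_prod v u) *\<^sub>v x) \<bullet>c y"
      by (rule sesquilinear_eq_sum[symmetric]) (simp_all add: J_def x y)
    finally show "(J Z W (outer_prod v u) *\<^sub>v x) \<bullet>c y
        = ip H (point_kernel_map H Z (outer_prod y v)) (point_kernel_map H W (outer_prod x u))"
      by (simp add: F_def)
  qed
  then show ?thesis unfolding kernel_of_def by blast
qed

end

text \<open>The functions \<open>h\<close> on which both inner products agree against every common element form a
  subspace that contains all kernel functions, hence is dense in \<open>H\<close>.\<close>

lemma nc_rkhs_embedding:
  assumes H: "nc_rkhs \<Omega> H" and H': "nc_rkhs \<Omega> H'"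
    and eq: "\<And>Z x u. \<lbrakk>Z \<in> \<Omega>; x \<in> carrier_vec (level Z); u \<in> carrier_vec (level Z)\<rbrakk>
      \<Longrightarrow> point_kernel_map H Z (outer_prod x u) = point_kernel_map H' Z (outer_prod x u)"
  shows "carrier H \<subseteq> carrier H'"
    and "\<lbrakk>f \<in> carrier H; g \<in> carrier H\<rbrakk> \<Longrightarrow> ip H f g = ip H' f g"
proof -
  interpret H: nc_rkhs_space H \<Omega> by (rule nc_rkhs_spaceI[OF H])
  interpret H': nc_rkhs_space H' \<Omega> by (rule nc_rkhs_spaceI[OF H'])
  define C where "C = carrier H \<inter> carrier H'"
  define D where "D = {h \<in> C. \<forall>f\<in>C. ip H h f = ip H' h f}"
  have ops: "\<zero>\<^bsub>H'\<^esub> = \<zero>\<^bsub>H\<^esub>" "f \<oplus>\<^bsub>H'\<^esub> g = f \<oplus>\<^bsub>H\<^esub> g" "a \<odot>\<^bsub>H'\<^esub> f = a \<odot>\<^bsub>H\<^esub> f" for a f g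
    by (simp_all add: H.zero_fun H'.zero_fun H.add_fun H'.add_fun H.smult_fun H'.smult_fun)
  have in': "\<zero>\<^bsub>H\<^esub> \<in> carrier H'" "\<lbrakk>f \<in> carrier H'; g \<in> carrier H'\<rbrakk> \<Longrightarrow> f \<oplus>\<^bsub>H\<^esub> g \<in> carrier H'"
    "f \<in> carrier H' \<Longrightarrow> a \<odot>\<^bsub>H\<^esub> f \<in> carrier H'" for a f g
    using H'.M.zero_closed H'.M.add.m_closed[of f g] H'.smult_in[of f a] by (simp_all add: ops)
  have ip': "f \<in> carrier H' \<Longrightarrow> ip H' \<zero>\<^bsub>H\<^esub> f = 0"
    "\<lbrakk>f \<in> carrier H'; g \<in> carrier H'; h \<in> carrier H'\<rbrakk> \<Longrightarrow> ip H' (f \<oplus>\<^bsub>H\<^esub> g) h = ip H' f h + ip H' g h"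
    "\<lbrakk>f \<in> carrier H'; h \<in> carrier H'\<rbrakk> \<Longrightarrow> ip H' (a \<odot>\<^bsub>H\<^esub> f) h = cnj a * ip H' f h" for a f g h
    using H'.ip_zero_left[of f] H'.ip_add_left[of f g h] H'.ip_smult_left[of f h a] by (simp_all add: ops)
  have D: "VectorSpace.subspace class_ring D H"
    by (rule complex_subspaceI[OF H.vectorspace_axioms])
      (auto simp: D_def C_def in' ip' H.ip_simps)
  \<comment> \<open>In either space the common kernel function pairs with f to <x u^*, f(Z)>, so the
    two inner products agree on it.\<close>
  have kD: "point_kernel_map H Z (outer_prod x u) \<in> D"
    if "Z \<in> \<Omega>" "x \<in> carrier_vec (level Z)" "u \<in> carrier_vec (level Z)" for Z x u
    using that H.point_kernel_map[of Z "outer_prod x u"] H'.point_kernel_map[of Z "outer_prod x u"]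
      eq[OF that] by (auto simp: D_def C_def)
  have approx: "\<exists>s. (\<forall>n. s n \<in> D) \<and> converges_to H s f \<and> converges_to H' s f \<and> f \<in> carrier H'"
    if f: "f \<in> carrier H" for f
  proof -
    have triv: "y = \<zero>\<^bsub>H\<^esub>" if "y \<in> carrier H" "\<And>m. m \<in> D \<Longrightarrow> ip H m y = 0" for y
      using that kD by (intro H.zero_if_orthogonal_to_kernels) auto
    obtain s where s: "\<And>n. s n \<in> D" "converges_to H s f"
      using H.dense_if_orthogonal_trivial[OF D f triv] by metis
    have sH: "s n \<in> carrier H" and sH': "s n \<in> carrier H'" for n
      using s(1)[of n] by (auto simp: D_def C_def)
    have norm: "hnorm H' (s m \<ominus>\<^bsub>H'\<^esub> s n) = hnorm H (s m \<ominus>\<^bsub>H\<^esub> s n)" for m n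
    proof -
      have "s m \<ominus>\<^bsub>H'\<^esub> s n = s m \<ominus>\<^bsub>H\<^esub> s n"
        using sH[of m] sH[of n] sH'[of m] sH'[of n] by (simp add: H.diff_fun H'.diff_fun)
      moreover have "s m \<ominus>\<^bsub>H\<^esub> s n \<in> D"
        using s(1) complex_subspaceD[OF D] sH by (simp add: H.diff_eq_smult)
      ultimately show ?thesis by (simp add: hnorm_def D_def)
    qed
    have "\<forall>e>0. \<exists>N. \<forall>m\<ge>N. \<forall>n\<ge>N. hnorm H' (s m \<ominus>\<^bsub>H'\<^esub> s n) < e"
      unfolding norm by (rule H.converges_to_Cauchy[OF sH f s(2)])
    then obtain g where g: "g \<in> carrier H'" "converges_to H' s g"
      using H'.complete[of s] sH' unfolding converges_to_def by blast
    \<comment> \<open>The limits are taken in two different norms, but each norm controls the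
      entries, so both functions are the entrywise limit of s.\<close>
    have "f = g"
    proof (rule free_nc_fun_ext[OF H.free[OF f] H'.free[OF g(1)]])
      fix Z i j assume Zij: "Z \<in> \<Omega>" "i < level Z" "j < level Z"
      show "f Z $$ (i, j) = g Z $$ (i, j)"
        by (rule LIMSEQ_unique[OF H.pointwise_tendsto[OF sH f s(2) Zij] H'.pointwise_tendsto[OF sH' g Zij]])
    qed
    then show ?thesis using s g by blast
  qed
  then show sub: "carrier H \<subseteq> carrier H'" by blast
  show "ip H f g = ip H' f g" if f: "f \<in> carrier H" and g: "g \<in> carrier H"
  proof -
    obtain s where s: "\<And>n. s n \<in> D" "converges_to H s g" "converges_to H' s g"
      using approx[OF g] by blast
    have sC: "s n \<in> carrier H" "s n \<in> carrier H'" for n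
      using s(1)[of n] by (auto simp: D_def C_def)
    \<comment> \<open>By the inclusion just proved f lies in C, so the condition that defines D
      applies to it.\<close>
    have "ip H f (s n) = ip H' f (s n)" for n
      using s(1)[of n] f sub H.ip_commute[of f "s n"] H'.ip_commute[of f "s n"] by (auto simp: D_def C_def)
    then show ?thesis
      using H.ip_tendsto[OF sC(1) g f s(2)] H'.ip_tendsto[OF sC(2) _ _ s(3), of f] f g sub
      by (auto intro: LIMSEQ_unique)
  qed
qed

text \<open>The shared kernel prescribes the entries of all kernel functions, so both spaces contain
  the same ones, and the embedding applies in both directions. Equality of records then comes from
  the normal form \<open>nc_fun_space\<close>.\<close>

theorem nc_rkhs_unique:
  assumes H: "nc_rkhs \<Omega> H" "kernel_of \<Omega> H K" and H': "nc_rkhs \<Omega> H'" "kernel_of \<Omega> H' K"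
  shows "H = H'"
proof -
  interpret H: nc_rkhs_space H \<Omega> by (rule nc_rkhs_spaceI[OF H(1)])
  interpret H': nc_rkhs_space H' \<Omega> by (rule nc_rkhs_spaceI[OF H'(1)])
  have eq: "point_kernel_map H W (outer_prod x u) = point_kernel_map H' W (outer_prod x u)"
    if W: "W \<in> \<Omega>" and xu: "x \<in> carrier_vec (level W)" "u \<in> carrier_vec (level W)" for W x u
  proof (rule free_nc_fun_ext[of \<Omega>])
    fix Z i j assume Z: "Z \<in> \<Omega>" and ij: "i < level Z" "j < level Z"
    have "kernel_at H Z W (K Z W)" "kernel_at H' Z W (K Z W)"
      using H(2) H'(2) Z W by (auto simp: kernel_of_def)
    then show "point_kernel_map H W (outer_prod x u) Z $$ (i, j) = point_kernel_map H' W (outer_prod x u) Z $$ (i, j)"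
      using H.kernel_values[OF _ Z W ij xu] H'.kernel_values[OF _ Z W ij xu] by simp
  next
    show "free_nc_fun \<Omega> (point_kernel_map H W (outer_prod x u))"
      using W xu by (intro H.free H.point_kernel_map(1)) simp_all
    show "free_nc_fun \<Omega> (point_kernel_map H' W (outer_prod x u))"
      using W xu by (intro H'.free H'.point_kernel_map(1)) simp_all
  qed
  have C: "carrier H = carrier H'"
    using nc_rkhs_embedding(1)[OF H(1) H'(1) eq] nc_rkhs_embedding(1)[OF H'(1) H(1) eq[symmetric]] by blast
  have "nc_fun_space \<Omega> (carrier H) (ip H) = nc_fun_space \<Omega> (carrier H) (ip H')"
    by (rule nc_fun_space_cong) (rule nc_rkhs_embedding(2)[OF H(1) H'(1) eq])
  then show ?thesis using H.space_eq H'.space_eq C by simp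
qed

text \<open>The way \<open>Hnc\<close> is evaluated for the join and the meet: exhibit a space with
  the right kernel.\<close>

lemma Hnc_eqI: "\<lbrakk>nc_rkhs \<Omega> H; kernel_of \<Omega> H K\<rbrakk> \<Longrightarrow> Hnc \<Omega> K = H"
  unfolding Hnc_def using nc_rkhs_unique by (intro the_equality) blast+

lemma cpnc_kernel_Hnc:
  assumes "cpnc_kernel \<Omega> K"
  shows "nc_rkhs \<Omega> (Hnc \<Omega> K)" "kernel_of \<Omega> (Hnc \<Omega> K) K"
  using assms Hnc_eqI by (auto simp: cpnc_kernel_def)

text \<open>Serves the meet with T = \<open>fst\<close> on the pairs (h, -h), and the join with T =
  \<open>sum_map\<close> on their orthogonal complement. T is an isometry onto its image by the
  choice of p, and closedness of N keeps limits taken in S inside N, which gives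
  completeness.\<close>

lemma nc_rkhs_transport:
  fixes S :: "('a, 'm) ip_space_scheme" and T :: "'a \<Rightarrow> nc_fun"
  assumes S: "hilbert_space S" and N: "VectorSpace.subspace class_ring N S"
    and closed: "\<And>s l. \<lbrakk>\<And>n. s n \<in> N; l \<in> carrier S; converges_to S s l\<rbrakk> \<Longrightarrow> l \<in> N"
    and free: "\<And>x. x \<in> N \<Longrightarrow> free_nc_fun \<Omega> (T x)"
    and add: "\<And>x y. \<lbrakk>x \<in> N; y \<in> N\<rbrakk> \<Longrightarrow> T (x \<oplus>\<^bsub>S\<^esub> y) = (\<lambda>Z\<in>\<Omega>. T x Z + T y Z)"
    and smult: "\<And>a x. x \<in> N \<Longrightarrow> T (a \<odot>\<^bsub>S\<^esub> x) = (\<lambda>Z\<in>\<Omega>. a \<cdot>\<^sub>m T x Z)"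
    and inj: "inj_on T N"
    and bound: "\<And>Z. Z \<in> \<Omega> \<Longrightarrow>
      \<exists>c. \<forall>x\<in>N. \<forall>i<level Z. \<forall>j<level Z. cmod (T x Z $$ (i, j)) \<le> c * hnorm S x"
    and p: "\<And>x y. \<lbrakk>x \<in> N; y \<in> N\<rbrakk> \<Longrightarrow> p (T x) (T y) = ip S x y"
  shows "nc_rkhs \<Omega> (nc_fun_space \<Omega> (T ` N) p)"
proof -
  interpret S: hilbert_space S by fact
  note ND = complex_subspaceD[OF N]
  have NS: "x \<in> carrier S" if "x \<in> N" for x using ND(1) that by blast
  define J where "J = nc_fun_space \<Omega> (T ` N) p"
  have carrier_J: "carrier J = T ` N" by (simp add: J_def nc_fun_space_simps)
  have TJ: "T x \<in> carrier J" if "x \<in> N" for x using that by (simp add: carrier_J)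
  have ip_J: "ip J (T x) (T y) = ip S x y" if "x \<in> N" "y \<in> N" for x y
    using that p by (simp add: J_def nc_fun_space_simps)
  have hnorm_J: "hnorm J (T x) = hnorm S x" if "x \<in> N" for x
    using that by (simp add: hnorm_def ip_J)
  have add_J: "T x \<oplus>\<^bsub>J\<^esub> T y = T (x \<oplus>\<^bsub>S\<^esub> y)" if "x \<in> N" "y \<in> N" for x y
    using that add by (simp add: J_def nc_fun_space_simps)
  have smult_J: "a \<odot>\<^bsub>J\<^esub> T x = T (a \<odot>\<^bsub>S\<^esub> x)" if "x \<in> N" for a x
    using that smult by (simp add: J_def nc_fun_space_simps)
  \<comment> \<open>The scalar multiple by 0 is used since T is only known to respect the two
    operations.\<close>
  have T0: "T \<zero>\<^bsub>S\<^esub> = (\<lambda>Z\<in>\<Omega>. 0\<^sub>m (level Z) (level Z))"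
  proof -
    have "dim_row (T \<zero>\<^bsub>S\<^esub> Z) = level Z" "dim_col (T \<zero>\<^bsub>S\<^esub> Z) = level Z" if "Z \<in> \<Omega>" for Z
      using free_nc_fun_carrier[OF free[OF ND(2)] that] by auto
    then have "(\<lambda>Z\<in>\<Omega>. 0 \<cdot>\<^sub>m T \<zero>\<^bsub>S\<^esub> Z) = (\<lambda>Z\<in>\<Omega>. 0\<^sub>m (level Z) (level Z))"
      by (intro restrict_ext eq_matI) auto
    then show ?thesis using smult[OF ND(2), of 0] by (simp add: S.zero_eq_smult)
  qed
  then have zero_J: "\<zero>\<^bsub>J\<^esub> = T \<zero>\<^bsub>S\<^esub>" by (simp add: J_def nc_fun_space_simps)
  have vs: "vectorspace class_ring J"
    unfolding J_def
  proof (rule nc_fun_space_vectorspace)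
    show "(\<lambda>Z\<in>\<Omega>. 0\<^sub>m (level Z) (level Z)) \<in> T ` N"
      using ND(2) T0 by (auto intro: image_eqI[of _ _ "\<zero>\<^bsub>S\<^esub>"])
  next
    fix f g assume "f \<in> T ` N" "g \<in> T ` N"
    then obtain x y where "x \<in> N" "y \<in> N" "f = T x" "g = T y" by blast
    then show "(\<lambda>Z\<in>\<Omega>. f Z + g Z) \<in> T ` N"
      using add[of x y] ND(3)[of x y] by (metis imageI)
  next
    fix a f assume "f \<in> T ` N"
    then obtain x where "x \<in> N" "f = T x" by blast
    then show "(\<lambda>Z\<in>\<Omega>. a \<cdot>\<^sub>m f Z) \<in> T ` N"
      using smult[of x a] ND(4)[of x a] by (metis imageI)
  qed (use free in auto)
  have diff_N: "x \<ominus>\<^bsub>S\<^esub> y \<in> N" if "x \<in> N" "y \<in> N" for x y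
    using ND(3)[OF that(1) ND(4)[OF that(2), of "-1"]] that NS by (simp add: S.diff_eq_smult)
  have diff_J: "T x \<ominus>\<^bsub>J\<^esub> T y = T (x \<ominus>\<^bsub>S\<^esub> y)" if "x \<in> N" "y \<in> N" for x y
    using that NS complex_vectorspace_diff[OF vs TJ TJ] ND(4)[OF that(2)]
    by (simp add: S.diff_eq_smult smult_J add_J)
  interpret J: vectorspace class_ring J by (rule vs)
  have "hilbert_space J"
  proof
    fix f g assume "f \<in> carrier J" "g \<in> carrier J"
    then obtain x y where xy: "x \<in> N" "y \<in> N" "f = T x" "g = T y" by (auto simp: carrier_J)
    then show "ip J f g = cnj (ip J g f)" using S.ip_commute[of x y] NS by (simp add: ip_J)
    show "ip J f (a \<odot>\<^bsub>J\<^esub> g) = a * ip J f g" for a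
      using xy NS ND(4)[of y a] by (simp add: ip_J smult_J S.ip_smult_right)
    fix h assume "h \<in> carrier J"
    then obtain z where z: "z \<in> N" "h = T z" by (auto simp: carrier_J)
    show "ip J f (g \<oplus>\<^bsub>J\<^esub> h) = ip J f g + ip J f h"
      using xy z NS ND(3)[of y z] by (simp add: ip_J add_J S.ip_add_right)
  next
    fix f assume "f \<in> carrier J"
    then obtain x where x: "x \<in> N" "f = T x" by (auto simp: carrier_J)
    show "0 \<le> Re (ip J f f)" using x NS S.ip_nonneg by (simp add: ip_J)
    show "f = \<zero>\<^bsub>J\<^esub>" if "ip J f f = 0"
      using that x NS S.ip_definite[of x] by (simp add: ip_J zero_J)
  next
    fix s :: "nat \<Rightarrow> nc_fun" assume s: "\<And>n. s n \<in> carrier J"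
      and Cauchy: "\<forall>e>0. \<exists>N. \<forall>m\<ge>N. \<forall>n\<ge>N. hnorm J (s m \<ominus>\<^bsub>J\<^esub> s n) < e"
    have "\<forall>n. \<exists>x\<in>N. s n = T x" using s by (auto simp: carrier_J)
    then obtain t where t: "\<And>n. t n \<in> N" "\<And>n. s n = T (t n)" by metis
    have "\<forall>e>0. \<exists>N. \<forall>m\<ge>N. \<forall>n\<ge>N. hnorm S (t m \<ominus>\<^bsub>S\<^esub> t n) < e"
      using Cauchy by (simp add: t diff_J hnorm_J diff_N)
    then obtain l where l: "l \<in> carrier S" "converges_to S t l"
      using S.complete[of t] NS t unfolding converges_to_def by blast
    then have "l \<in> N" using closed t by blast
    then show "\<exists>l\<in>carrier J. (\<lambda>n. hnorm J (s n \<ominus>\<^bsub>J\<^esub> l)) \<longlonglongrightarrow> 0"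
      using l t TJ by (intro bexI[of _ "T l"]) (auto simp: converges_to_def diff_J hnorm_J diff_N)
  qed
  then have "nc_rkhs \<Omega> J"
  proof (rule nc_rkhsI[OF J_def])
    fix Z assume "Z \<in> \<Omega>"
    from bound[OF this] show "\<exists>c. \<forall>f\<in>T ` N. \<forall>i<level Z. \<forall>j<level Z. cmod (f Z $$ (i, j)) \<le> c * hnorm J f"
      by (auto simp: hnorm_J)
  qed (use free in auto)
  then show ?thesis by (simp add: J_def)
qed

section \<open>Join and meet\<close>

locale kernel_pair =
  fixes d :: nat and \<Omega> :: "nc_point set" and K k :: nc_kernel
  assumes nc_set: "nc_set d \<Omega>" and K: "cpnc_kernel \<Omega> K" and k: "cpnc_kernel \<Omega> k"
begin

abbreviation H where "H \<equiv> Hnc \<Omega> K"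
abbreviation H' where "H' \<equiv> Hnc \<Omega> k"
abbreviation S where "S \<equiv> sum_space \<Omega> K k"

end

sublocale kernel_pair \<subseteq> H: nc_rkhs_space "Hnc \<Omega> K" \<Omega>
  by (rule nc_rkhs_spaceI[OF cpnc_kernel_Hnc(1)[OF K]])

sublocale kernel_pair \<subseteq> H': nc_rkhs_space "Hnc \<Omega> k" \<Omega>
  by (rule nc_rkhs_spaceI[OF cpnc_kernel_Hnc(1)[OF k]])

sublocale kernel_pair \<subseteq> S: hilbert_space "sum_space \<Omega> K k"
  unfolding sum_space_def
  by (rule hilbert_space_hilbert_sum) unfold_locales

context kernel_pair
begin

lemmas S_simps = hilbert_sum_simps[of H H', folded sum_space_def]

lemma S_carrier: "x \<in> carrier S \<longleftrightarrow> fst x \<in> carrier H \<and> snd x \<in> carrier H'"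
  by (simp add: S_simps mem_Times_iff)

lemma S_dims:
  assumes "x \<in> carrier S" "Z \<in> \<Omega>"
  shows "dim_row (fst x Z) = level Z" "dim_col (fst x Z) = level Z"
    "dim_row (snd x Z) = level Z" "dim_col (snd x Z) = level Z"
  using assms H.value_carrier[of "fst x" Z] H'.value_carrier[of "snd x" Z] by (auto simp: S_carrier)

lemma S_converges_to:
  assumes "\<And>n. s n \<in> carrier S" "l \<in> carrier S" "converges_to S s l"
  shows "converges_to H (\<lambda>n. fst (s n)) (fst l)" "converges_to H' (\<lambda>n. snd (s n)) (snd l)"
  using assms hilbert_sum_converges_to_iff[OF H.hilbert_space_axioms H'.hilbert_space_axioms, of s l]
  by (simp_all add: sum_space_def)

lemma S_bounded_entries:
  assumes Z: "Z \<in> \<Omega>"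
  obtains c where "0 \<le> c"
    "\<And>x i j. \<lbrakk>x \<in> carrier S; i < level Z; j < level Z\<rbrakk> \<Longrightarrow> cmod (fst x Z $$ (i, j)) \<le> c * hnorm S x"
    "\<And>x i j. \<lbrakk>x \<in> carrier S; i < level Z; j < level Z\<rbrakk> \<Longrightarrow> cmod (snd x Z $$ (i, j)) \<le> c * hnorm S x"
proof -
  obtain a where a: "0 \<le> a"
    "\<And>f i j. \<lbrakk>f \<in> carrier H; i < level Z; j < level Z\<rbrakk> \<Longrightarrow> cmod (f Z $$ (i, j)) \<le> a * hnorm H f"
    using H.bounded_entries[OF Z] by metis
  obtain b where b: "0 \<le> b"
    "\<And>f i j. \<lbrakk>f \<in> carrier H'; i < level Z; j < level Z\<rbrakk> \<Longrightarrow> cmod (f Z $$ (i, j)) \<le> b * hnorm H' f"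
    using H'.bounded_entries[OF Z] by metis
  show thesis
  proof (rule that[of "max a b"])
    show "0 \<le> max a b" using a by simp
    fix x i j assume x: "x \<in> carrier S" and ij: "i < level Z" "j < level Z"
    have f: "fst x \<in> carrier H" "snd x \<in> carrier H'" using x by (simp_all add: S_carrier)
    have le: "hnorm H (fst x) \<le> hnorm S x" "hnorm H' (snd x) \<le> hnorm S x"
      using hnorm_hilbert_sum_bounds(1,2)[OF H.hilbert_space_axioms H'.hilbert_space_axioms, folded sum_space_def, OF x]
      by simp_all
    have "a * hnorm H (fst x) \<le> max a b * hnorm S x" "b * hnorm H' (snd x) \<le> max a b * hnorm S x"
      using le a(1) b(1) H.hnorm_nonneg[OF f(1)] H'.hnorm_nonneg[OF f(2)] by (auto intro!: mult_mono)
    then show "cmod (fst x Z $$ (i, j)) \<le> max a b * hnorm S x"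
      "cmod (snd x Z $$ (i, j)) \<le> max a b * hnorm S x"
      using a(2)[OF f(1) ij] b(2)[OF f(2) ij] by linarith+
  qed
qed

section \<open>The sum map, its kernel and the orthogonal complement\<close>

definition sum_map :: "nc_fun \<times> nc_fun \<Rightarrow> nc_fun" where
  "sum_map x = (\<lambda>Z\<in>\<Omega>. fst x Z + snd x Z)"

lemma sum_map_entry:
  "\<lbrakk>x \<in> carrier S; Z \<in> \<Omega>; i < level Z; j < level Z\<rbrakk>
    \<Longrightarrow> sum_map x Z $$ (i, j) = fst x Z $$ (i, j) + snd x Z $$ (i, j)"
  by (simp add: sum_map_def S_dims)

lemma sum_map_free: "x \<in> carrier S \<Longrightarrow> free_nc_fun \<Omega> (sum_map x)"
  unfolding sum_map_def by (intro free_nc_fun_add[OF nc_set] H.free H'.free) (simp_all add: S_carrier)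

lemma sum_map_dims:
  assumes "x \<in> carrier S" "Z \<in> \<Omega>"
  shows "dim_row (sum_map x Z) = level Z" "dim_col (sum_map x Z) = level Z"
  using free_nc_fun_carrier[OF sum_map_free[OF assms(1)] assms(2)] by auto

lemma sum_map_add:
  "\<lbrakk>x \<in> carrier S; y \<in> carrier S\<rbrakk> \<Longrightarrow> sum_map (x \<oplus>\<^bsub>S\<^esub> y) = (\<lambda>Z\<in>\<Omega>. sum_map x Z + sum_map y Z)"
  by (auto simp: sum_map_def S_simps(3) H.add_fun H'.add_fun S_dims intro!: restrict_ext eq_matI)

lemma sum_map_smult:
  "x \<in> carrier S \<Longrightarrow> sum_map (a \<odot>\<^bsub>S\<^esub> x) = (\<lambda>Z\<in>\<Omega>. a \<cdot>\<^sub>m sum_map x Z)"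
  by (auto simp: sum_map_def S_simps(4) H.smult_fun H'.smult_fun S_dims distrib_left intro!: restrict_ext eq_matI)

text \<open>The kernel of \<open>sum_map\<close>. Asking for vanishing entries, rather than for the
  form (h, -h), makes linearity and closedness pointwise statements.\<close>

definition meet_range :: "(nc_fun \<times> nc_fun) set" where
  "meet_range = {x \<in> carrier S. \<forall>Z\<in>\<Omega>. \<forall>i<level Z. \<forall>j<level Z. sum_map x Z $$ (i, j) = 0}"

definition join_range :: "(nc_fun \<times> nc_fun) set" where
  "join_range = {x \<in> carrier S. \<forall>m\<in>meet_range. ip S m x = 0}"

text \<open>If a pair has zero sum, its first component is the negative of its second as a function.
  It therefore lies in the space of k as well, hence in the intersection.\<close>

lemma meet_range_eq: "U_meet \<Omega> K k ` (carrier H \<inter> carrier H') = meet_range"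
proof (intro subset_antisym subsetI)
  fix x assume "x \<in> U_meet \<Omega> K k ` (carrier H \<inter> carrier H')"
  then obtain h where h: "h \<in> carrier H" "h \<in> carrier H'" "x = (h, \<ominus>\<^bsub>H'\<^esub> h)"
    by (auto simp: U_meet_def)
  then have x: "x \<in> carrier S" by (simp add: S_carrier)
  then show "x \<in> meet_range"
    using h H.value_carrier[OF h(1), THEN carrier_matD(1)] H.value_carrier[OF h(1), THEN carrier_matD(2)]
    by (auto simp: meet_range_def sum_map_entry H'.neg_fun)
next
  fix x assume x: "x \<in> meet_range"
  then have xS: "x \<in> carrier S" by (simp add: meet_range_def)
  then have c: "fst x \<in> carrier H" "snd x \<in> carrier H'" by (simp_all add: S_carrier)
  have entry: "fst x Z $$ (i, j) + snd x Z $$ (i, j) = 0" if "Z \<in> \<Omega>" "i < level Z" "j < level Z" for Z i j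
    using x that sum_map_entry[OF xS that] by (simp add: meet_range_def)
  have 1: "snd x = \<ominus>\<^bsub>H\<^esub> fst x"
  proof (rule free_nc_fun_ext[of \<Omega>])
    show "snd x Z $$ (i, j) = (\<ominus>\<^bsub>H\<^esub> fst x) Z $$ (i, j)" if "Z \<in> \<Omega>" "i < level Z" "j < level Z" for Z i j
      using entry[OF that] that c S_dims[OF xS that(1)] by (simp add: H.neg_fun add_eq_0_iff)
  qed (use c H.free H'.free in auto)
  have 2: "fst x = \<ominus>\<^bsub>H'\<^esub> snd x"
  proof (rule free_nc_fun_ext[of \<Omega>])
    show "fst x Z $$ (i, j) = (\<ominus>\<^bsub>H'\<^esub> snd x) Z $$ (i, j)" if "Z \<in> \<Omega>" "i < level Z" "j < level Z" for Z i j
      using entry[OF that] that c S_dims[OF xS that(1)] by (simp add: H'.neg_fun add_eq_0_iff2)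
  qed (use c H.free H'.free in auto)
  have "fst x \<in> carrier H'" using 2 c by simp
  moreover have "x = U_meet \<Omega> K k (fst x)"
    unfolding U_meet_def using 2 c by (metis H'.M.minus_minus prod.collapse)
  ultimately show "x \<in> U_meet \<Omega> K k ` (carrier H \<inter> carrier H')" using c by blast
qed

lemma meet_range_subspace: "VectorSpace.subspace class_ring meet_range S"
proof (rule complex_subspaceI[OF S.vectorspace_axioms])
  show "meet_range \<subseteq> carrier S" by (auto simp: meet_range_def)
  have "sum_map \<zero>\<^bsub>S\<^esub> Z $$ (i, j) = 0" if "Z \<in> \<Omega>" "i < level Z" "j < level Z" for Z i j
    using that by (simp add: sum_map_entry[OF S.M.zero_closed that]) (simp add: S_simps(2) H.zero_fun H'.zero_fun)
  then show "\<zero>\<^bsub>S\<^esub> \<in> meet_range" by (simp add: meet_range_def)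
next
  fix x y assume "x \<in> meet_range" "y \<in> meet_range"
  then show "x \<oplus>\<^bsub>S\<^esub> y \<in> meet_range"
    by (auto simp: meet_range_def sum_map_add sum_map_dims)
next
  fix a x assume "x \<in> meet_range"
  then show "a \<odot>\<^bsub>S\<^esub> x \<in> meet_range"
    by (auto simp: meet_range_def sum_map_smult sum_map_dims)
qed

lemma meet_range_closed:
  assumes s: "\<And>n. s n \<in> meet_range" and l: "l \<in> carrier S" and conv: "converges_to S s l"
  shows "l \<in> meet_range"
proof -
  have sS: "s n \<in> carrier S" for n using s[of n] by (simp add: meet_range_def)
  have c: "fst (s n) \<in> carrier H" "snd (s n) \<in> carrier H'" for n using sS by (simp_all add: S_carrier)
  have lc: "fst l \<in> carrier H" "snd l \<in> carrier H'" using l by (simp_all add: S_carrier)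
  have "sum_map l Z $$ (i, j) = 0" if Z: "Z \<in> \<Omega>" "i < level Z" "j < level Z" for Z i j
  proof -
    have "(\<lambda>n. fst (s n) Z $$ (i, j) + snd (s n) Z $$ (i, j)) \<longlonglongrightarrow> fst l Z $$ (i, j) + snd l Z $$ (i, j)"
      using S_converges_to[OF sS l conv] Z c lc
      by (intro tendsto_add H.pointwise_tendsto H'.pointwise_tendsto)
    moreover have "fst (s n) Z $$ (i, j) + snd (s n) Z $$ (i, j) = 0" for n
    proof -
      have "sum_map (s n) Z $$ (i, j) = 0" using s[of n] Z by (simp add: meet_range_def)
      then show ?thesis by (simp add: sum_map_entry[OF sS Z])
    qed
    ultimately show ?thesis using Z l by (simp add: sum_map_entry LIMSEQ_const_iff)
  qed
  then show ?thesis using l by (simp add: meet_range_def)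
qed

lemma join_range_subspace: "VectorSpace.subspace class_ring join_range S"
  by (rule complex_subspaceI[OF S.vectorspace_axioms])
    (auto simp: join_range_def meet_range_def S.ip_simps)

lemma join_range_closed:
  assumes s: "\<And>n. s n \<in> join_range" and l: "l \<in> carrier S" and conv: "converges_to S s l"
  shows "l \<in> join_range"
proof -
  have "ip S m l = 0" if m: "m \<in> meet_range" for m
  proof -
    have "m \<in> carrier S" "s n \<in> carrier S" for n
      using m s[of n] by (auto simp: meet_range_def join_range_def)
    then have "(\<lambda>n. ip S m (s n)) \<longlonglongrightarrow> ip S m l"
      using l conv by (intro S.ip_tendsto)
    moreover have "ip S m (s n) = 0" for n using s[of n] m by (simp add: join_range_def)
    ultimately show ?thesis by (simp add: LIMSEQ_const_iff)
  qed
  then show ?thesis using l by (simp add: join_range_def)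
qed

text \<open>The difference of two elements with equal sums lies in \<open>meet_range\<close>, so it
  is orthogonal to both of them and hence to itself.\<close>

lemma sum_map_inj: "inj_on sum_map join_range"
proof (rule inj_onI)
  fix x y assume x: "x \<in> join_range" and y: "y \<in> join_range" and eq: "sum_map x = sum_map y"
  have xy: "x \<in> carrier S" "y \<in> carrier S" using x y by (auto simp: join_range_def)
  have "x \<ominus>\<^bsub>S\<^esub> y \<in> meet_range"
    using xy eq by (auto simp: meet_range_def S.diff_eq_smult sum_map_add sum_map_smult sum_map_dims)
  then have "ip S (x \<ominus>\<^bsub>S\<^esub> y) x = 0" "ip S (x \<ominus>\<^bsub>S\<^esub> y) y = 0"
    using x y by (simp_all add: join_range_def)
  then have "ip S (x \<ominus>\<^bsub>S\<^esub> y) (x \<ominus>\<^bsub>S\<^esub> y) = 0"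
    using xy by (simp add: S.ip_diff_right)
  then show "x = y" using xy S.ip_definite[of "x \<ominus>\<^bsub>S\<^esub> y"] by (simp add: S.diff_eq_zero_iff)
qed

lemma orthogonal_decomposition: "orthogonal_direct_sum S join_range meet_range"
  unfolding orthogonal_direct_sum_def
proof (intro conjI ballI join_range_subspace meet_range_subspace)
  fix x y assume x: "x \<in> join_range" and y: "y \<in> meet_range"
  then have "ip S y x = 0" by (simp add: join_range_def)
  then show "ip S x y = 0"
    using x y S.ip_commute[of x y] by (simp add: join_range_def meet_range_def)
next
  have "\<exists>y z. x = y \<oplus>\<^bsub>S\<^esub> z \<and> y \<in> join_range \<and> z \<in> meet_range" if x: "x \<in> carrier S" for x
  proof -
    obtain p s where p: "p \<in> carrier S" "\<And>n. s n \<in> meet_range" "converges_to S s p"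
      "\<And>m. m \<in> meet_range \<Longrightarrow> ip S m (x \<ominus>\<^bsub>S\<^esub> p) = 0"
      using S.projection_onto_closure[OF meet_range_subspace x] by metis
    \<comment> \<open>Closedness turns the projection onto the closure into a projection onto
      \<open>meet_range\<close> itself.\<close>
    have "p \<in> meet_range" using meet_range_closed p by blast
    moreover have "x \<ominus>\<^bsub>S\<^esub> p \<in> join_range" using x p by (simp add: join_range_def)
    moreover have "x = (x \<ominus>\<^bsub>S\<^esub> p) \<oplus>\<^bsub>S\<^esub> p"
      using x p by (intro S.eqI_ip) (simp_all add: S.ip_simps)
    ultimately show ?thesis by blast
  qed
  then show "carrier S = {x \<oplus>\<^bsub>S\<^esub> y |x y. x \<in> join_range \<and> y \<in> meet_range}"
    by (auto simp: join_range_def meet_range_def)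
qed

section \<open>The meet space and its isometry\<close>

text \<open>The meet norm of h is the norm of the pair (h, -h), the two signs cancelling in the
  second summand. So the meet space is the image of the closed subspace \<open>meet_range\<close>
  under \<open>fst\<close>.\<close>

lemma meet_space_rkhs: "nc_rkhs \<Omega> (meet_space \<Omega> K k)"
proof -
  have sub: "x \<in> carrier S" "fst x \<in> carrier H" if "x \<in> meet_range" for x
    using that by (simp_all add: meet_range_def S_carrier)
  have form: "fst x \<in> carrier H'" "snd x = \<ominus>\<^bsub>H'\<^esub> fst x" if "x \<in> meet_range" for x
    using that unfolding meet_range_eq[symmetric] by (auto simp: U_meet_def)
  have "nc_rkhs \<Omega> (nc_fun_space \<Omega> (fst ` meet_range) (\<lambda>f g. ip H f g + ip H' f g))"
  proof (rule nc_rkhs_transport[OF S.hilbert_space_axioms meet_range_subspace meet_range_closed])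
    show "inj_on fst meet_range"
      by (rule inj_onI) (metis form(2) prod.collapse)
    show "free_nc_fun \<Omega> (fst x)" if "x \<in> meet_range" for x
      using sub(2)[OF that] by (rule H.free)
    show "fst (x \<oplus>\<^bsub>S\<^esub> y) = (\<lambda>Z\<in>\<Omega>. fst x Z + fst y Z)" for x y
      by (simp add: S_simps(3) H.add_fun)
    show "fst (a \<odot>\<^bsub>S\<^esub> x) = (\<lambda>Z\<in>\<Omega>. a \<cdot>\<^sub>m fst x Z)" for a x
      by (simp add: S_simps(4) H.smult_fun)
    show "ip H (fst x) (fst y) + ip H' (fst x) (fst y) = ip S x y" if "x \<in> meet_range" "y \<in> meet_range" for x y
      using form[OF that(1)] form[OF that(2)] by (simp add: S_simps(5) H'.ip_neg_left H'.ip_neg_right)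
    fix Z assume "Z \<in> \<Omega>"
    from S_bounded_entries[OF this]
    show "\<exists>c. \<forall>x\<in>meet_range. \<forall>i<level Z. \<forall>j<level Z. cmod (fst x Z $$ (i, j)) \<le> c * hnorm S x"
      using sub(1) by metis
  qed
  moreover have "fst ` meet_range = carrier H \<inter> carrier H'"
    unfolding meet_range_eq[symmetric] by (auto simp: U_meet_def image_iff)
  ultimately show ?thesis by (simp add: meet_space_def)
qed

lemma kernel_meet: "kernel_of \<Omega> (meet_space \<Omega> K k) (kernel_meet \<Omega> K k)"
  unfolding kernel_meet_def
  by (rule someI_ex[OF nc_rkhs_space.kernel_exists[OF nc_rkhs_spaceI[OF meet_space_rkhs]]])

lemma Hnc_meet: "Hnc \<Omega> (kernel_meet \<Omega> K k) = meet_space \<Omega> K k"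
  by (rule Hnc_eqI[OF meet_space_rkhs kernel_meet])

lemma meet_space_simps:
  "carrier (meet_space \<Omega> K k) = carrier H \<inter> carrier H'"
  "\<lbrakk>f \<in> carrier H \<inter> carrier H'; g \<in> carrier H \<inter> carrier H'\<rbrakk>
    \<Longrightarrow> ip (meet_space \<Omega> K k) f g = ip H f g + ip H' f g"
  by (simp_all add: meet_space_def nc_fun_space_simps)

sublocale meet: nc_rkhs_space "meet_space \<Omega> K k" \<Omega>
  by (rule nc_rkhs_spaceI[OF meet_space_rkhs])

text \<open>The operations of all three function spaces are the same pointwise ones, so linearity
  only requires carrying the sign through.\<close>

lemma isometry_U_meet: "isometry (meet_space \<Omega> K k) S (U_meet \<Omega> K k)"
  unfolding isometry_def
proof (intro conjI ballI complex_linear_mapI meet.vectorspace_axioms S.vectorspace_axioms)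
  fix x assume x: "x \<in> carrier (meet_space \<Omega> K k)"
  then show "U_meet \<Omega> K k x \<in> carrier S"
    by (simp add: U_meet_def S_carrier meet_space_simps)
  show "U_meet \<Omega> K k (a \<odot>\<^bsub>meet_space \<Omega> K k\<^esub> x) = a \<odot>\<^bsub>S\<^esub> U_meet \<Omega> K k x" for a
  proof -
    have "a \<odot>\<^bsub>meet_space \<Omega> K k\<^esub> x = a \<odot>\<^bsub>H\<^esub> x" "a \<odot>\<^bsub>H\<^esub> x = a \<odot>\<^bsub>H'\<^esub> x"
      by (simp_all add: meet.smult_fun H.smult_fun H'.smult_fun)
    moreover have "\<ominus>\<^bsub>H'\<^esub> (a \<odot>\<^bsub>H'\<^esub> x) = a \<odot>\<^bsub>H'\<^esub> (\<ominus>\<^bsub>H'\<^esub> x)"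
      using x by (intro H'.eqI_ip) (simp_all add: H'.ip_simps meet_space_simps)
    ultimately show ?thesis by (simp add: U_meet_def S_simps)
  qed
  show "hnorm S (U_meet \<Omega> K k x) = hnorm (meet_space \<Omega> K k) x"
    using x by (simp add: hnorm_def U_meet_def S_simps meet_space_simps H'.ip_simps)
  fix y assume y: "y \<in> carrier (meet_space \<Omega> K k)"
  show "U_meet \<Omega> K k (x \<oplus>\<^bsub>meet_space \<Omega> K k\<^esub> y) = U_meet \<Omega> K k x \<oplus>\<^bsub>S\<^esub> U_meet \<Omega> K k y"
  proof -
    have "x \<oplus>\<^bsub>meet_space \<Omega> K k\<^esub> y = x \<oplus>\<^bsub>H\<^esub> y" "x \<oplus>\<^bsub>H\<^esub> y = x \<oplus>\<^bsub>H'\<^esub> y"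
      by (simp_all add: meet.add_fun H.add_fun H'.add_fun)
    moreover have "\<ominus>\<^bsub>H'\<^esub> (x \<oplus>\<^bsub>H'\<^esub> y) = \<ominus>\<^bsub>H'\<^esub> x \<oplus>\<^bsub>H'\<^esub> \<ominus>\<^bsub>H'\<^esub> y"
      using x y by (intro H'.eqI_ip) (simp_all add: H'.ip_simps meet_space_simps)
    ultimately show ?thesis by (simp add: U_meet_def S_simps)
  qed
qed

section \<open>The join space and its kernel\<close>

text \<open>The preimages of f under \<open>sum_map\<close> differ by elements of
  \<open>meet_range\<close>, and the one in \<open>join_range\<close> has the least norm. This is
  thus the quotient inner product.\<close>

definition join_ip :: "nc_fun \<Rightarrow> nc_fun \<Rightarrow> complex" where
  "join_ip f g = ip S (inv_into join_range sum_map f) (inv_into join_range sum_map g)"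

definition join_space :: "nc_fun ip_space" where
  "join_space = nc_fun_space \<Omega> (sum_map ` join_range) join_ip"

lemma join_range_carrier: "x \<in> join_range \<Longrightarrow> x \<in> carrier S"
  by (simp add: join_range_def)

lemma join_ip: "\<lbrakk>x \<in> join_range; y \<in> join_range\<rbrakk> \<Longrightarrow> join_ip (sum_map x) (sum_map y) = ip S x y"
  by (simp add: join_ip_def inv_into_f_f[OF sum_map_inj])

lemma join_space_simps:
  "carrier join_space = sum_map ` join_range"
  "\<lbrakk>x \<in> join_range; y \<in> join_range\<rbrakk> \<Longrightarrow> ip join_space (sum_map x) (sum_map y) = ip S x y"
  by (simp_all add: join_space_def nc_fun_space_simps join_ip)

lemma join_space_rkhs: "nc_rkhs \<Omega> join_space"
  unfolding join_space_def
proof (rule nc_rkhs_transport[OF S.hilbert_space_axioms join_range_subspace join_range_closed])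
  fix Z assume Z: "Z \<in> \<Omega>"
  obtain c where c: "0 \<le> c"
    "\<And>x i j. \<lbrakk>x \<in> carrier S; i < level Z; j < level Z\<rbrakk> \<Longrightarrow> cmod (fst x Z $$ (i, j)) \<le> c * hnorm S x"
    "\<And>x i j. \<lbrakk>x \<in> carrier S; i < level Z; j < level Z\<rbrakk> \<Longrightarrow> cmod (snd x Z $$ (i, j)) \<le> c * hnorm S x"
    using S_bounded_entries[OF Z] by metis
  have "cmod (sum_map x Z $$ (i, j)) \<le> 2 * c * hnorm S x"
    if x: "x \<in> carrier S" and ij: "i < level Z" "j < level Z" for x i j
    using c(2,3)[OF that] norm_triangle_ineq[of "fst x Z $$ (i, j)" "snd x Z $$ (i, j)"]
    by (simp add: sum_map_entry[OF x Z ij])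
  then show "\<exists>c. \<forall>x\<in>join_range. \<forall>i<level Z. \<forall>j<level Z. cmod (sum_map x Z $$ (i, j)) \<le> c * hnorm S x"
    using join_range_carrier by blast
qed (simp_all add: sum_map_free sum_map_add sum_map_smult sum_map_inj join_ip join_range_carrier)

sublocale join: nc_rkhs_space join_space \<Omega>
  by (rule nc_rkhs_spaceI[OF join_space_rkhs])

text \<open>Against (h, -h) the two components contribute <A, h(Z)> and -<A, h(Z)>, which
  cancel.\<close>

lemma kernel_pair_in_join_range:
  assumes "Z \<in> \<Omega>" "A \<in> carrier_mat (level Z) (level Z)"
  shows "(point_kernel_map H Z A, point_kernel_map H' Z A) \<in> join_range"
proof -
  let ?x = "(point_kernel_map H Z A, point_kernel_map H' Z A)"
  have x: "?x \<in> carrier S" using assms by (simp add: S_carrier H.point_kernel_map H'.point_kernel_map)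
  have "ip S ?x m = 0" if m: "m \<in> meet_range" for m
  proof -
    obtain h where h: "h \<in> carrier H" "h \<in> carrier H'" "m = (h, \<ominus>\<^bsub>H'\<^esub> h)"
      using m unfolding meet_range_eq[symmetric] by (auto simp: U_meet_def)
    then show ?thesis
      using assms by (simp add: S_simps H'.ip_neg_right H.point_kernel_map H'.point_kernel_map)
  qed
  then show ?thesis
    using x S.ip_commute[OF _ x] by (auto simp: join_range_def meet_range_def)
qed

lemma point_kernel_map_join:
  assumes Z: "Z \<in> \<Omega>" and A: "A \<in> carrier_mat (level Z) (level Z)"
  shows "point_kernel_map join_space Z A = sum_map (point_kernel_map H Z A, point_kernel_map H' Z A)"
proof (rule join.point_kernel_map_eqI)
  let ?x = "(point_kernel_map H Z A, point_kernel_map H' Z A)"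
  note x = kernel_pair_in_join_range[OF Z A]
  show "sum_map ?x \<in> carrier join_space" using x by (simp add: join_space_simps)
  fix f assume "f \<in> carrier join_space"
  then obtain y where y: "y \<in> join_range" "f = sum_map y" by (auto simp: join_space_simps)
  have yS: "y \<in> carrier S" using y by (simp add: join_range_carrier)
  then have yc: "fst y \<in> carrier H" "snd y \<in> carrier H'" by (simp_all add: S_carrier)
  \<comment> \<open>Both preimages lie in \<open>join_range\<close>, so the inner product is that of
    the pairs, and each component reproduces its own half of f.\<close>
  have "ip join_space (sum_map ?x) f = ip (mat_hilbert (level Z)) A (fst y Z) + ip (mat_hilbert (level Z)) A (snd y Z)"
    using x y yc Z A by (simp add: join_space_simps S_simps H.point_kernel_map H'.point_kernel_map)
  also have "\<dots> = ip (mat_hilbert (level Z)) A (f Z)"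
    using A H.value_carrier[OF yc(1) Z] H'.value_carrier[OF yc(2) Z] Z
      free_nc_fun_carrier[OF sum_map_free[OF yS] Z] y(2)
    by (simp add: mat_hilbert_ip[of _ "level Z"] sum_map_entry[OF yS] distrib_left sum.distrib)
  finally show "ip join_space (sum_map ?x) f = ip (mat_hilbert (level Z)) A (f Z)" .
qed

lemma kernel_join: "kernel_of \<Omega> join_space (kernel_join K k)"
  unfolding kernel_of_def kernel_at_def
proof (intro conjI ballI)
  fix Z W assume Z: "Z \<in> \<Omega>" and W: "W \<in> \<Omega>"
  let ?n = "level Z" and ?m = "level W"
  have KZ: "kernel_at H Z W (K Z W)" and kZ: "kernel_at H' Z W (k Z W)"
    using cpnc_kernel_Hnc(2)[OF K] cpnc_kernel_Hnc(2)[OF k] Z W by (auto simp: kernel_of_def)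
  note lK = complex_linear_mapD[OF KZ[unfolded kernel_at_def, THEN conjunct1], unfolded module_mat_simps]
  note lk = complex_linear_mapD[OF kZ[unfolded kernel_at_def, THEN conjunct1], unfolded module_mat_simps]
  show "linear_map class_ring (module_mat TYPE(complex) ?n ?m) (module_mat TYPE(complex) ?n ?m) (kernel_join K k Z W)"
  proof (intro complex_linear_mapI matrix_vs, unfold module_mat_simps kernel_join_def)
    fix P :: "complex mat" assume P: "P \<in> carrier_mat ?n ?m"
    note cP = lK(3)[OF P] lk(3)[OF P]
    show "K Z W P + k Z W P \<in> carrier_mat ?n ?m" using cP by simp
    show "K Z W (a \<cdot>\<^sub>m P) + k Z W (a \<cdot>\<^sub>m P) = a \<cdot>\<^sub>m (K Z W P + k Z W P)" for a
      using cP by (simp add: lK(5)[OF P] lk(5)[OF P] add_smult_distrib_left_mat)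
    fix Q :: "complex mat" assume Q: "Q \<in> carrier_mat ?n ?m"
    note cQ = lK(3)[OF Q] lk(3)[OF Q]
    show "K Z W (P + Q) + k Z W (P + Q) = K Z W P + k Z W P + (K Z W Q + k Z W Q)"
      unfolding lK(4)[OF P Q] lk(4)[OF P Q] using cP cQ by (intro eq_matI) auto
  qed
  fix y v x u :: "complex vec" assume y: "y \<in> carrier_vec ?n" and v: "v \<in> carrier_vec ?n"
    and x: "x \<in> carrier_vec ?m" and u: "u \<in> carrier_vec ?m"
  note P = outer_prod_carrier[OF v u]
  have "(kernel_join K k Z W (outer_prod v u) *\<^sub>v x) \<bullet>c y
      = (K Z W (outer_prod v u) *\<^sub>v x) \<bullet>c y + (k Z W (outer_prod v u) *\<^sub>v x) \<bullet>c y"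
    using lK(3)[OF P] lk(3)[OF P] x y
    by (simp add: kernel_join_def sesquilinear_eq_sum[of _ ?n ?m] distrib_left distrib_right sum.distrib)
  also have "\<dots> = ip H (point_kernel_map H Z (outer_prod y v)) (point_kernel_map H W (outer_prod x u))
      + ip H' (point_kernel_map H' Z (outer_prod y v)) (point_kernel_map H' W (outer_prod x u))"
    using KZ kZ y v x u by (simp add: kernel_at_def)
  \<comment> \<open>Read from right to left: kernel functions of the join are sums of pairs in
    \<open>join_range\<close>, and the inner product of two pairs splits into the K part and the k
    part.\<close>
  also have "\<dots> = ip join_space (point_kernel_map join_space Z (outer_prod y v)) (point_kernel_map join_space W (outer_prod x u))"
    using kernel_pair_in_join_range[OF Z outer_prod_carrier[OF y v]]
      kernel_pair_in_join_range[OF W outer_prod_carrier[OF x u]]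
      point_kernel_map_join[OF Z outer_prod_carrier[OF y v]]
      point_kernel_map_join[OF W outer_prod_carrier[OF x u]]
    by (simp add: join_space_simps S_simps)
  finally show "(kernel_join K k Z W (outer_prod v u) *\<^sub>v x) \<bullet>c y
      = ip join_space (point_kernel_map join_space Z (outer_prod y v)) (point_kernel_map join_space W (outer_prod x u))" .
qed

lemma Hnc_join: "Hnc \<Omega> (kernel_join K k) = join_space"
  by (rule Hnc_eqI[OF join_space_rkhs kernel_join])

section \<open>Existence and uniqueness of the join isometry\<close>

text \<open>The join inner product was defined through this inverse, so isometry is built in. The
  restriction to the carrier meets the demand for an extensional function, without which
  \<open>U_join\<close> would not be unique.\<close>

lemma is_U_join_inverse: "is_U_join \<Omega> K k (restrict (inv_into join_range sum_map) (carrier join_space))"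
  (is "is_U_join \<Omega> K k ?U")
proof -
  have U: "?U (sum_map x) = x" if "x \<in> join_range" for x
    using that by (simp add: join_space_simps inv_into_f_f[OF sum_map_inj])
  note JD = complex_subspaceD[OF join_range_subspace]
  have add: "sum_map x \<oplus>\<^bsub>join_space\<^esub> sum_map y = sum_map (x \<oplus>\<^bsub>S\<^esub> y)" if "x \<in> join_range" "y \<in> join_range" for x y
    using that by (simp add: join.add_fun sum_map_add join_range_carrier)
  have smult: "a \<odot>\<^bsub>join_space\<^esub> sum_map x = sum_map (a \<odot>\<^bsub>S\<^esub> x)" if "x \<in> join_range" for a x
    using that by (simp add: join.smult_fun sum_map_smult join_range_carrier)
  have "isometry join_space S ?U"
    unfolding isometry_def
  proof (intro conjI ballI complex_linear_mapI join.vectorspace_axioms S.vectorspace_axioms)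
    fix f assume "f \<in> carrier join_space"
    then obtain x where x: "x \<in> join_range" "f = sum_map x" by (auto simp: join_space_simps)
    show "?U f \<in> carrier S" unfolding x(2) U[OF x(1)] by (rule join_range_carrier[OF x(1)])
    show "?U (a \<odot>\<^bsub>join_space\<^esub> f) = a \<odot>\<^bsub>S\<^esub> ?U f" for a
      unfolding x(2) smult[OF x(1)] U[OF x(1)] U[OF JD(4)[OF x(1)]] ..
    show "hnorm S (?U f) = hnorm join_space f"
      unfolding x(2) U[OF x(1)] using x(1) by (simp add: hnorm_def join_space_simps)
    fix g assume "g \<in> carrier join_space"
    then obtain y where y: "y \<in> join_range" "g = sum_map y" by (auto simp: join_space_simps)
    show "?U (f \<oplus>\<^bsub>join_space\<^esub> g) = ?U f \<oplus>\<^bsub>S\<^esub> ?U g"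
      unfolding x(2) y(2) add[OF x(1) y(1)] U[OF x(1)] U[OF y(1)] U[OF JD(3)[OF x(1) y(1)]] ..
  qed
  then show ?thesis
    unfolding is_U_join_def Hnc_join kernel_map_def
    using U[OF kernel_pair_in_join_range] by (simp add: point_kernel_map_join)
qed

text \<open>Two candidates agree on a subspace that contains the kernel functions, hence is dense;
  isometries are continuous, so they agree on the carrier, and being extensional also off
  it.\<close>

lemma is_U_join_unique:
  assumes U: "is_U_join \<Omega> K k U" and U': "is_U_join \<Omega> K k U'"
  shows "U = U'"
proof (rule extensionalityI)
  show "U \<in> extensional (carrier join_space)" "U' \<in> extensional (carrier join_space)"
    using U U' by (simp_all add: is_U_join_def Hnc_join)
  have iso: "isometry join_space S U" "isometry join_space S U'"
    using U U' by (simp_all add: is_U_join_def Hnc_join)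
  note l = complex_linear_mapD[OF iso(1)[unfolded isometry_def, THEN conjunct1]]
  note l' = complex_linear_mapD[OF iso(2)[unfolded isometry_def, THEN conjunct1]]
  define D where "D = {f \<in> carrier join_space. U f = U' f}"
  have "U \<zero>\<^bsub>join_space\<^esub> = 0 \<odot>\<^bsub>S\<^esub> U \<zero>\<^bsub>join_space\<^esub>" "U' \<zero>\<^bsub>join_space\<^esub> = 0 \<odot>\<^bsub>S\<^esub> U' \<zero>\<^bsub>join_space\<^esub>"
    using l(5)[of "\<zero>\<^bsub>join_space\<^esub>" 0] l'(5)[of "\<zero>\<^bsub>join_space\<^esub>" 0] by (simp_all add: join.zero_eq_smult)
  then have U0: "U \<zero>\<^bsub>join_space\<^esub> = U' \<zero>\<^bsub>join_space\<^esub>"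
    using l(3) l'(3) by (simp add: S.zero_eq_smult)
  have D: "VectorSpace.subspace class_ring D join_space"
    by (rule complex_subspaceI[OF join.vectorspace_axioms]) (auto simp: D_def U0 l l')
  have kD: "point_kernel_map join_space Z (outer_prod x u) \<in> D"
    if "Z \<in> \<Omega>" "x \<in> carrier_vec (level Z)" "u \<in> carrier_vec (level Z)" for Z x u
    using that U U' by (auto simp: D_def is_U_join_def Hnc_join kernel_map_def join.point_kernel_map)
  fix f assume f: "f \<in> carrier join_space"
  have triv: "y = \<zero>\<^bsub>join_space\<^esub>" if "y \<in> carrier join_space" "\<And>m. m \<in> D \<Longrightarrow> ip join_space m y = 0" for y
    using that kD by (intro join.zero_if_orthogonal_to_kernels) auto
  obtain s where s: "\<And>n. s n \<in> D" "converges_to join_space s f"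
    using join.dense_if_orthogonal_trivial[OF D f triv] by metis
  have sJ: "s n \<in> carrier join_space" and sU: "U (s n) = U' (s n)" for n
    using s(1)[of n] by (simp_all add: D_def)
  have dist: "hnorm S (V (s n) \<ominus>\<^bsub>S\<^esub> V f) = hnorm join_space (s n \<ominus>\<^bsub>join_space\<^esub> f)"
    if V: "isometry join_space S V" for V n
  proof -
    note l = complex_linear_mapD[OF V[unfolded isometry_def, THEN conjunct1]]
    have "V (s n \<ominus>\<^bsub>join_space\<^esub> f) = V (s n) \<ominus>\<^bsub>S\<^esub> V f"
      using sJ f by (simp add: join.diff_eq_smult S.diff_eq_smult l)
    then show ?thesis
      using V sJ[of n] f unfolding isometry_def by (metis join.M.minus_closed)
  qed
  have in_S: "U f \<in> carrier S" "U' f \<in> carrier S" "U (s n) \<in> carrier S" for n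
    using f sJ l(3) l'(3) by simp_all
  \<comment> \<open>Passing through the common value at \<open>s n\<close> costs the same distance
    once for U and once for U', hence the factor 2.\<close>
  have "hnorm S (U f \<ominus>\<^bsub>S\<^esub> U' f) \<le> 2 * hnorm join_space (s n \<ominus>\<^bsub>join_space\<^esub> f)" for n
    using S.hnorm_diff_triangle[OF in_S(1) in_S(3) in_S(2), of n] S.hnorm_diff_commute[OF in_S(1) in_S(3), of n]
      dist[OF iso(1), of n] dist[OF iso(2), of n] by (simp add: sU)
  moreover have "(\<lambda>n. 2 * hnorm join_space (s n \<ominus>\<^bsub>join_space\<^esub> f)) \<longlonglongrightarrow> 0"
    using s(2) tendsto_mult_right_zero unfolding converges_to_def by blast
  ultimately have "hnorm S (U f \<ominus>\<^bsub>S\<^esub> U' f) \<le> 0" by (meson LIMSEQ_le_const)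
  then have "hnorm S (U f \<ominus>\<^bsub>S\<^esub> U' f) = 0"
    using S.hnorm_nonneg[of "U f \<ominus>\<^bsub>S\<^esub> U' f"] in_S by simp
  then show "U f = U' f" using S.eqI_diff in_S by blast
qed

lemma ex1_U_join: "\<exists>!U. is_U_join \<Omega> K k U"
  using is_U_join_inverse is_U_join_unique by blast

lemma U_join_image: "U_join \<Omega> K k ` carrier join_space = join_range"
proof -
  have "U_join \<Omega> K k = restrict (inv_into join_range sum_map) (carrier join_space)"
    unfolding U_join_def
    by (rule the_equality) (rule is_U_join_inverse, rule is_U_join_unique[OF _ is_U_join_inverse])
  then show ?thesis
    by (auto simp: join_space_simps image_image inv_into_f_f[OF sum_map_inj])
qed

section \<open>The adjoint formulas for the meet kernel\<close>

lemma U_meet_adj_eqI: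
  assumes "g \<in> carrier (meet_space \<Omega> K k)"
    and "\<And>h. h \<in> carrier (meet_space \<Omega> K k) \<Longrightarrow> ip (meet_space \<Omega> K k) g h = ip H (fst x) h + ip H' (snd x) (\<ominus>\<^bsub>H'\<^esub> h)"
  shows "U_meet_adj \<Omega> K k x = g"
  unfolding U_meet_adj_def Hnc_meet
  by (rule meet.adjoint_eqI[OF assms(1)]) (simp add: assms(2) S_simps U_meet_def)

text \<open>Paired with (h, -h), each of (K_Z A, 0) and (0, -k_Z A) yields <A, h(Z)>, in the second
  case because two signs cancel. Each alone therefore reproduces evaluation in the meet space; taken
  together they do so twice, which is where 1/2 comes from.\<close>

lemma kernel_map_meet:
  assumes Z: "Z \<in> \<Omega>" and A: "A \<in> carrier_mat (level Z) (level Z)"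
  shows "kernel_map \<Omega> (kernel_meet \<Omega> K k) Z A = (1/2) \<odot>\<^bsub>meet_space \<Omega> K k\<^esub>
      U_meet_adj \<Omega> K k (kernel_map \<Omega> K Z A, \<ominus>\<^bsub>H'\<^esub> kernel_map \<Omega> k Z A)"
    and "kernel_map \<Omega> (kernel_meet \<Omega> K k) Z A = U_meet_adj \<Omega> K k (kernel_map \<Omega> K Z A, \<zero>\<^bsub>H'\<^esub>)"
    and "kernel_map \<Omega> (kernel_meet \<Omega> K k) Z A = U_meet_adj \<Omega> K k (\<zero>\<^bsub>H\<^esub>, \<ominus>\<^bsub>H'\<^esub> kernel_map \<Omega> k Z A)"
proof -
  define g where "g = kernel_map \<Omega> (kernel_meet \<Omega> K k) Z A"
  have g: "g \<in> carrier (meet_space \<Omega> K k)"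
    "\<And>h. h \<in> carrier (meet_space \<Omega> K k) \<Longrightarrow> ip (meet_space \<Omega> K k) g h = ip (mat_hilbert (level Z)) A (h Z)"
    using meet.point_kernel_map[OF Z A] by (simp_all add: g_def kernel_map_def Hnc_meet)
  have K: "kernel_map \<Omega> K Z A \<in> carrier H"
    "\<And>h. h \<in> carrier H \<Longrightarrow> ip H (kernel_map \<Omega> K Z A) h = ip (mat_hilbert (level Z)) A (h Z)"
    using H.point_kernel_map[OF Z A] by (simp_all add: kernel_map_def)
  have k: "kernel_map \<Omega> k Z A \<in> carrier H'"
    "\<And>h. h \<in> carrier H' \<Longrightarrow> ip H' (kernel_map \<Omega> k Z A) h = ip (mat_hilbert (level Z)) A (h Z)"
    using H'.point_kernel_map[OF Z A] by (simp_all add: kernel_map_def)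
  show "g = U_meet_adj \<Omega> K k (kernel_map \<Omega> K Z A, \<zero>\<^bsub>H'\<^esub>)"
    using g K by (intro U_meet_adj_eqI[symmetric]) (simp_all add: meet_space_simps(1) H'.ip_simps)
  show "g = U_meet_adj \<Omega> K k (\<zero>\<^bsub>H\<^esub>, \<ominus>\<^bsub>H'\<^esub> kernel_map \<Omega> k Z A)"
    using g k by (intro U_meet_adj_eqI[symmetric]) (simp_all add: meet_space_simps(1) H'.ip_simps H.ip_simps)
  have "U_meet_adj \<Omega> K k (kernel_map \<Omega> K Z A, \<ominus>\<^bsub>H'\<^esub> kernel_map \<Omega> k Z A) = 2 \<odot>\<^bsub>meet_space \<Omega> K k\<^esub> g"
  proof (rule U_meet_adj_eqI)
    show "2 \<odot>\<^bsub>meet_space \<Omega> K k\<^esub> g \<in> carrier (meet_space \<Omega> K k)" using g(1) by (rule meet.smult_in)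
    fix h assume h: "h \<in> carrier (meet_space \<Omega> K k)"
    then show "ip (meet_space \<Omega> K k) (2 \<odot>\<^bsub>meet_space \<Omega> K k\<^esub> g) h
        = ip H (fst (kernel_map \<Omega> K Z A, \<ominus>\<^bsub>H'\<^esub> kernel_map \<Omega> k Z A)) h
        + ip H' (snd (kernel_map \<Omega> K Z A, \<ominus>\<^bsub>H'\<^esub> kernel_map \<Omega> k Z A)) (\<ominus>\<^bsub>H'\<^esub> h)"
      using meet.ip_smult_left[OF g(1) h, of 2] g(2)[OF h] K k
      by (simp add: meet_space_simps(1) H'.ip_simps)
  qed
  moreover have "(1/2) \<odot>\<^bsub>meet_space \<Omega> K k\<^esub> (2 \<odot>\<^bsub>meet_space \<Omega> K k\<^esub> g) = g"
  proof (rule meet.eqI_ip)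
    fix h assume h: "h \<in> carrier (meet_space \<Omega> K k)"
    show "ip (meet_space \<Omega> K k) ((1/2) \<odot>\<^bsub>meet_space \<Omega> K k\<^esub> (2 \<odot>\<^bsub>meet_space \<Omega> K k\<^esub> g)) h = ip (meet_space \<Omega> K k) g h"
      using meet.ip_smult_left[OF meet.smult_in[OF g(1)] h] meet.ip_smult_left[OF g(1) h] by simp
  qed (use g(1) meet.smult_in in blast)+
  ultimately show "g = (1/2) \<odot>\<^bsub>meet_space \<Omega> K k\<^esub>
      U_meet_adj \<Omega> K k (kernel_map \<Omega> K Z A, \<ominus>\<^bsub>H'\<^esub> kernel_map \<Omega> k Z A)" by simp
qed

end

theorem theorem5p2:
  fixes d :: nat and \<Omega> :: "nc_point set" and K k :: nc_kernel
  assumes "d \<ge> 1" and "nc_set d \<Omega>" and "cpnc_kernel \<Omega> K" and "cpnc_kernel \<Omega> k"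
  shows "cpnc_kernel \<Omega> (kernel_join K k) \<and>
    cpnc_kernel \<Omega> (kernel_meet \<Omega> K k) \<and>
    Hnc \<Omega> (kernel_meet \<Omega> K k) = meet_space \<Omega> K k \<and>
    (\<exists>!U. is_U_join \<Omega> K k U) \<and>
    isometry (Hnc \<Omega> (kernel_meet \<Omega> K k)) (sum_space \<Omega> K k) (U_meet \<Omega> K k) \<and>
    orthogonal_direct_sum (sum_space \<Omega> K k)
      (U_join \<Omega> K k ` carrier (Hnc \<Omega> (kernel_join K k)))
      (U_meet \<Omega> K k ` carrier (Hnc \<Omega> (kernel_meet \<Omega> K k))) \<and>
    (\<forall>Z\<in>\<Omega>. \<forall>A\<in>carrier_mat (level Z) (level Z).
      kernel_map \<Omega> (kernel_meet \<Omega> K k) Z A =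
        (1/2) \<odot>\<^bsub>Hnc \<Omega> (kernel_meet \<Omega> K k)\<^esub>
          U_meet_adj \<Omega> K k (kernel_map \<Omega> K Z A, \<ominus>\<^bsub>Hnc \<Omega> k\<^esub> kernel_map \<Omega> k Z A) \<and>
      kernel_map \<Omega> (kernel_meet \<Omega> K k) Z A =
        U_meet_adj \<Omega> K k (kernel_map \<Omega> K Z A, \<zero>\<^bsub>Hnc \<Omega> k\<^esub>) \<and>
      kernel_map \<Omega> (kernel_meet \<Omega> K k) Z A =
        U_meet_adj \<Omega> K k (\<zero>\<^bsub>Hnc \<Omega> K\<^esub>, \<ominus>\<^bsub>Hnc \<Omega> k\<^esub> kernel_map \<Omega> k Z A))"
proof -
  interpret kernel_pair d \<Omega> K k using assms by unfold_locales
  have "cpnc_kernel \<Omega> (kernel_join K k)" "cpnc_kernel \<Omega> (kernel_meet \<Omega> K k)"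
    unfolding cpnc_kernel_def using join_space_rkhs kernel_join meet_space_rkhs kernel_meet by blast+
  then show ?thesis
    unfolding Hnc_meet Hnc_join U_join_image meet_space_simps(1) meet_range_eq
    using ex1_U_join isometry_U_meet orthogonal_decomposition kernel_map_meet by blast
qed

end
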